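(* Let $(X,d)$ be a metric space, let $F=(a_0,\dots,a_m)\in P_m(X)$, and let $\ell=|F|$. Then there is an isomorphism of chain complexes (up to sign of the boundary operators) $$B_\bullet^F(X)\simeq \mathrm{Tot}^{\oplus}\bigl(C_\bullet(I(a_0,a_1))\otimes\cdots\otimes C_\bullet(I(a_{m-1},a_m))\bigr)_{\bullet-2m}.$$
   Context: Let $(X,d)$ be a metric space. For $x,y,z\in X$ write $x\preceq y\preceq z$ if $d(x,y)+d(y,z)=d(x,z)$, and $x\prec y\prec z$ if moreover $x\neq y$ and $y\neq z$. A tuple $\boldsymbol{x}=(x_0,\dots,x_n)\in X^{n+1}$ is a proper chain of degree $n$ if $x_{i-1}\neq x_i$ for all $i=1,\dots,n$; its length is $|\boldsymbol{x}|=\sum_{i=1}^n d(x_{i-1},x_i)$. $P_n(X)$ is the set of proper chains of degree $n$, and $P_n^{\ell}(X)$ is the set of those of length $\ell$. For $\boldsymbol{x}=(x_0,\dots,x_n)\in P_n(X)$, the point $x_i$ is smooth if $1\le i\le n-1$ and $x_{i-1}\prec x_i\prec x_{i+1}$, and singular otherwise. The frame $\varphi(\boldsymbol{x})$ is the tuple of all singular points of $\boldsymbol{x}$, in order. For $F\in P_m(X)$, set $P_n^F(X)=\{\boldsymbol{x}\in P_n^{|F|}(X)\mid\varphi(\boldsymbol{x})=F\}$ and $B_n^F(X)=\bigoplus_{\boldsymbol{x}\in P_n^F(X)}\mathbb{Z}\cdot\langle\boldsymbol{x}\rangle$. This is a chain complex with $\partial_n=\sum_i(-1)^i\partial_{n,i}$,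 where $\partial_{n,i}\langle x_0,\dots,x_n\rangle=\langle x_0,\dots,\widehat{x_i},\dots,x_n\rangle$ if $x_i$ is smooth and $0$ if $x_i$ is singular. For $a,b\in X$, $I(a,b)=I_X(a,b):=\{x\in X\mid a\prec x\prec b\}$ is a poset with $x\le y$ iff $a\prec x\preceq y$, i.e. iff $a\neq x$ and $d(a,x)+d(x,y)=d(a,y)$. For a poset $P$, $C_\bullet(P)$ is the reduced (augmented) chain complex of the order complex of $P$: $C_n(P)=\bigoplus_{x_0<\cdots<x_n}\mathbb{Z}\cdot\langle x_0,\dots,x_n\rangle$ for $n\ge0$, $C_{-1}(P)=\mathbb{Z}$, and $C_n(P)=0$ for $n<-1$; the boundary is $\partial_n\langle x_0,\dots,x_n\rangle=\sum_i(-1)^i\langle x_0,\dots,\widehat{x_i},\dots,x_n\rangle$ for $n\ge1$, and $\partial_0\langle x\rangle=1$. $\mathrm{Tot}^{\oplus}(C^1_\bullet\otimes\cdots\otimes C^m_\bullet)_\bullet$ is the usual tensor product complex, with degree $n$ part $\bigoplus_{i_1+\cdots+i_m=n}C^1_{i_1}\otimes\cdots\otimes C^m_{i_m}$ and boundary on $C^1_{i_1}\otimes\cdots\otimes C^m_{i_m}$ given by $\sum_{h=1}^m(-1)^{i_1+\cdots+i_{h-1}}\mathrm{id}\otimes\cdots\otimes\partial^h_{i_h}\otimes\cdots\otimes\mathrm{id}$. The subscript $\bullet-2m$ means that the degree $n$ part on the left corresponds to the degree $n-2m$ part on the right. "Isomorphism up to sign of the boundary operators" means a family of group isomorphisms $\phi_n$,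 one in each degree $n$, such that for each $n$, $\phi_{n-1}\circ\partial_n=\pm\,\partial_{n-2m}\circ\phi_n$.
   Formalization: Added hypothesis: for 0<j<m, if a_{j-1}⪯y⪯a_j⪯z⪯a_{j+1}, then a_j is not strictly between y and z. Without it the claim fails: for X={0,1,2}⊂ℝ, F=(0,1,2), the left side is 0 and the right side is ℤ in degree 2. *)

theory Defs
  imports "HOL-Algebra.Free_Abelian_Groups" "HOL-Analysis.Abstract_Metric_Spaces"
begin

section \<open>Proper chains, smooth points and frames\<close>

text \<open>A tuple \<open>(x\<^sub>0, \<dots>, x\<^sub>n)\<close> is the list \<open>[x\<^sub>0, \<dots>, x\<^sub>n]\<close> of length \<open>n + 1\<close>; a metric space
  is a carrier \<open>X\<close> with a distance \<open>d\<close>, as in the library locale \<^locale>\<open>Metric_space\<close>.  All degrees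
  are integers, so that shifted complexes need no case distinction.\<close>

definition between :: "('a \<Rightarrow> 'a \<Rightarrow> real) \<Rightarrow> 'a \<Rightarrow> 'a \<Rightarrow> 'a \<Rightarrow> bool" where
  "between d x y z \<longleftrightarrow> d x y + d y z = d x z"

definition strictly_between :: "('a \<Rightarrow> 'a \<Rightarrow> real) \<Rightarrow> 'a \<Rightarrow> 'a \<Rightarrow> 'a \<Rightarrow> bool" where
  "strictly_between d x y z \<longleftrightarrow> between d x y z \<and> x \<noteq> y \<and> y \<noteq> z"

definition proper_chains :: "'a set \<Rightarrow> int \<Rightarrow> 'a list set" where
  "proper_chains X n =
    {x. x \<noteq> [] \<and> int (length x) = n + 1 \<and> set x \<subseteq> X \<and> (\<forall>i\<in>{1..<length x}. x ! (i - 1) \<noteq> x ! i)}"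

definition chain_length :: "('a \<Rightarrow> 'a \<Rightarrow> real) \<Rightarrow> 'a list \<Rightarrow> real" where
  "chain_length d x = (\<Sum>i = 1..<length x. d (x ! (i - 1)) (x ! i))"

definition smooth :: "('a \<Rightarrow> 'a \<Rightarrow> real) \<Rightarrow> 'a list \<Rightarrow> nat \<Rightarrow> bool" where
  "smooth d x i \<longleftrightarrow>
    1 \<le> i \<and> i + 1 < length x \<and> strictly_between d (x ! (i - 1)) (x ! i) (x ! (i + 1))"

definition frame :: "('a \<Rightarrow> 'a \<Rightarrow> real) \<Rightarrow> 'a list \<Rightarrow> 'a list" where
  "frame d x = nths x {i. \<not> smooth d x i}"

definition frame_chains :: "'a set \<Rightarrow> ('a \<Rightarrow> 'a \<Rightarrow> real) \<Rightarrow> 'a list \<Rightarrow> int \<Rightarrow> 'a list set" where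
  "frame_chains X d F n =
    {x \<in> proper_chains X n. chain_length d x = chain_length d F \<and> frame d x = F}"

definition omit :: "nat \<Rightarrow> 'a list \<Rightarrow> 'a list" where
  "omit i x = take i x @ drop (Suc i) x"

section \<open>Chain complexes\<close>

text \<open>Abelian groups are multiplicatively written \<^typ>\<open>'g monoid\<close> records, as in HOL-Algebra.\<close>

record 'g graded_complex =
  grp :: "int \<Rightarrow> 'g monoid"
  bdry :: "int \<Rightarrow> 'g \<Rightarrow> 'g"

definition is_chain_complex :: "'g graded_complex \<Rightarrow> bool" where
  "is_chain_complex C \<longleftrightarrow>
    (\<forall>n. comm_group (grp C n) \<and> bdry C n \<in> hom (grp C n) (grp C (n - 1)) \<and>
         (\<forall>x \<in> carrier (grp C n). bdry C (n - 1) (bdry C n x) = \<one>\<^bsub>grp C (n - 2)\<^esub>))"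

text \<open>\<open>C\<^sub>\<bullet> \<simeq> D\<^bsub>\<bullet> - k\<^esub>\<close> up to sign of the boundary operators: the sign may depend on the degree
  \<open>n\<close>, but not on the element.\<close>

definition iso_up_to_sign :: "'g graded_complex \<Rightarrow> 'h graded_complex \<Rightarrow> int \<Rightarrow> bool" where
  "iso_up_to_sign C D k \<longleftrightarrow>
    is_chain_complex C \<and> is_chain_complex D \<and>
    (\<exists>\<phi>. \<forall>n.
      \<phi> n \<in> iso (grp C n) (grp D (n - k)) \<and>
      ((\<forall>x \<in> carrier (grp C n). \<phi> (n - 1) (bdry C n x) = bdry D (n - k) (\<phi> n x)) \<or>
       (\<forall>x \<in> carrier (grp C n).
          \<phi> (n - 1) (bdry C n x) = inv\<^bsub>grp D (n - k - 1)\<^esub> (bdry D (n - k) (\<phi> n x)))))"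

definition frame_complex ::
  "'a set \<Rightarrow> ('a \<Rightarrow> 'a \<Rightarrow> real) \<Rightarrow> 'a list \<Rightarrow> ('a list \<Rightarrow>\<^sub>0 int) graded_complex" where
  "frame_complex X d F =
    \<lparr>grp = (\<lambda>n. free_Abelian_group (frame_chains X d F n)),
     bdry = (\<lambda>n. frag_extend (\<lambda>x. \<Sum>i<length x.
       if smooth d x i then frag_cmul ((- 1) ^ i) (frag_of (omit i x)) else 0))\<rparr>"

section \<open>Interval posets and order complexes\<close>

definition interval :: "'a set \<Rightarrow> ('a \<Rightarrow> 'a \<Rightarrow> real) \<Rightarrow> 'a \<Rightarrow> 'a \<Rightarrow> 'a set" where
  "interval X d a b = {x \<in> X. strictly_between d a x b}"

definition interval_le :: "('a \<Rightarrow> 'a \<Rightarrow> real) \<Rightarrow> 'a \<Rightarrow> 'a \<Rightarrow> 'a \<Rightarrow> bool" where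
  "interval_le d a x y \<longleftrightarrow> a \<noteq> x \<and> between d a x y"

text \<open>A poset is given by its carrier \<open>P\<close> and its order relation \<open>R\<close>.  The augmentation is encoded
  by the empty simplex: in degree \<open>-1\<close> the only simplex is \<open>[]\<close>, so \<open>C\<^bsub>-1\<^esub>(P)\<close> is the free abelian
  group \<open>\<int>\<cdot>\<langle>\<rangle>\<close>, and \<open>\<partial>\<^sub>0\<langle>x\<rangle> = \<langle>\<rangle>\<close> is its generator \<open>1\<close>.\<close>

definition order_simplices :: "'a set \<Rightarrow> ('a \<Rightarrow> 'a \<Rightarrow> bool) \<Rightarrow> int \<Rightarrow> 'a list set" where
  "order_simplices P R n =
    {x. int (length x) = n + 1 \<and> set x \<subseteq> P \<and> sorted_wrt (\<lambda>u v. R u v \<and> u \<noteq> v) x}"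

definition order_complex ::
  "'a set \<Rightarrow> ('a \<Rightarrow> 'a \<Rightarrow> bool) \<Rightarrow> ('a list \<Rightarrow>\<^sub>0 int) graded_complex" where
  "order_complex P R =
    \<lparr>grp = (\<lambda>n. free_Abelian_group (order_simplices P R n)),
     bdry = (\<lambda>n. frag_extend (\<lambda>x. \<Sum>i<length x. frag_cmul ((- 1) ^ i) (frag_of (omit i x))))\<rparr>"

section \<open>Tensor products\<close>

text \<open>The tensor product over \<open>\<int>\<close> of a family \<open>(A\<^sub>h)\<close>, \<open>h \<in> I\<close>: the free abelian group on the
  Cartesian product modulo additivity in each variable.  (Additivity implies \<open>\<int>\<close>-linearity, and the
  empty tensor product is \<open>\<int>\<close>.)\<close>

definition tensor_relators :: "'i set \<Rightarrow> ('i \<Rightarrow> 'g monoid) \<Rightarrow> (('i \<Rightarrow> 'g) \<Rightarrow>\<^sub>0 int) set" where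
  "tensor_relators I A =
    {frag_of (x(h := u \<otimes>\<^bsub>A h\<^esub> v)) - frag_of (x(h := u)) - frag_of (x(h := v)) | x h u v.
       x \<in> (\<Pi>\<^sub>E i\<in>I. carrier (A i)) \<and> h \<in> I \<and> u \<in> carrier (A h) \<and> v \<in> carrier (A h)}"

definition tensor_null :: "'i set \<Rightarrow> ('i \<Rightarrow> 'g monoid) \<Rightarrow> (('i \<Rightarrow> 'g) \<Rightarrow>\<^sub>0 int) set" where
  "tensor_null I A =
    generate (free_Abelian_group (\<Pi>\<^sub>E i\<in>I. carrier (A i))) (tensor_relators I A)"

definition tensor_product :: "'i set \<Rightarrow> ('i \<Rightarrow> 'g monoid) \<Rightarrow> (('i \<Rightarrow> 'g) \<Rightarrow>\<^sub>0 int) set monoid" where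
  "tensor_product I A = free_Abelian_group (\<Pi>\<^sub>E i\<in>I. carrier (A i)) Mod tensor_null I A"

text \<open>The homomorphism of tensor products (into that of the family \<open>B\<close>) induced by homomorphisms
  \<open>f h\<close> into \<open>B h\<close>; the image of a coset is computed on representatives.\<close>

definition tensor_map ::
  "'i set \<Rightarrow> ('i \<Rightarrow> 'h monoid) \<Rightarrow> ('i \<Rightarrow> 'g \<Rightarrow> 'h) \<Rightarrow>
   (('i \<Rightarrow> 'g) \<Rightarrow>\<^sub>0 int) set \<Rightarrow> (('i \<Rightarrow> 'h) \<Rightarrow>\<^sub>0 int) set" where
  "tensor_map I B f K = the_elem
    ((\<lambda>c. tensor_null I B #>\<^bsub>free_Abelian_group (\<Pi>\<^sub>E i\<in>I. carrier (B i))\<^esub>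
            frag_extend (\<lambda>x. frag_of (\<lambda>i\<in>I. f i (x i))) c) ` K)"

definition multidegrees :: "nat \<Rightarrow> int \<Rightarrow> (nat \<Rightarrow> int) set" where
  "multidegrees m n = {i \<in> {1..m} \<rightarrow>\<^sub>E UNIV. (\<Sum>h = 1..m. i h) = n}"

text \<open>The total complex of \<open>C\<^sup>1 \<otimes> \<cdots> \<otimes> C\<^sup>m\<close>.  An element of degree \<open>n\<close> is a finitely supported family
  \<open>(t\<^sub>i)\<close> indexed by the multidegrees \<open>i\<close> of sum \<open>n\<close>.  The component of its boundary in multidegree
  \<open>j\<close> is contributed by the multidegrees \<open>i = j(h := j h + 1)\<close>, for \<open>h = 1, \<dots>, m\<close>, via
  \<open>id \<otimes> \<cdots> \<otimes> \<partial>\<^sup>h \<otimes> \<cdots> \<otimes> id\<close>; since \<open>i\<close> and \<open>j\<close> agree before \<open>h\<close>, the sign is determined by the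
  parity of \<open>j 1 + \<cdots> + j (h - 1)\<close>.\<close>

definition total_complex ::
  "nat \<Rightarrow> (nat \<Rightarrow> 'g graded_complex) \<Rightarrow>
   ((nat \<Rightarrow> int) \<Rightarrow> ((nat \<Rightarrow> 'g) \<Rightarrow>\<^sub>0 int) set) graded_complex" where
  "total_complex m C =
    \<lparr>grp = (\<lambda>n. sum_group (multidegrees m n)
              (\<lambda>i. tensor_product {1..m} (\<lambda>h. grp (C h) (i h)))),
     bdry = (\<lambda>n t. \<lambda>j\<in>multidegrees m (n - 1).
       let T = tensor_product {1..m} (\<lambda>g. grp (C g) (j g))
       in \<Otimes>\<^bsub>T\<^esub>h\<in>{1..m}.
            tensor_map {1..m} (\<lambda>g. grp (C g) (j g))
              (\<lambda>g. if g = h then bdry (C h) (j h + 1) else id)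
              (t (j(h := j h + 1)))
            [^]\<^bsub>T\<^esub> (if even (\<Sum>g = 1..<h. j g) then 1 else - 1 :: int))\<rparr>"

section \<open>Stability of frames\<close>

text \<open>A point \<open>a\<^sub>j\<close> of \<open>F = (a\<^sub>0, \<dots>, a\<^sub>m)\<close> can be smooth in \<open>F\<close>, or become smooth after points of the
  adjacent intervals are inserted into \<open>F\<close>, although this does not change the length.  Then \<open>F\<close> is not
  the frame of the refined chain, and the interval posets see chains that the frame complex does not.
  Two examples: \<open>F = (0, 1, 2)\<close> in \<open>X = {0, 1, 2} \<subseteq> \<real>\<close>, where the frame complex is \<open>0\<close> but
  \<open>C\<^bsub>-1\<^esub> \<otimes> C\<^bsub>-1\<^esub> = \<int>\<close> sits in degree \<open>2\<close> of the shifted tensor product; and \<open>F = (0, 2, 4)\<close>, its own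
  frame, in the 6-cycle, where the frame complex is \<open>\<int>\<close> in degree \<open>2\<close> but the tensor product is
  acyclic.
  Stability rules this out: whenever \<open>a\<^bsub>j-1\<^esub> \<preceq> y \<preceq> a\<^sub>j \<preceq> z \<preceq> a\<^bsub>j+1\<^esub>\<close> with \<open>y, z \<noteq> a\<^sub>j\<close>, the
  point \<open>a\<^sub>j\<close> is not between \<open>y\<close> and \<open>z\<close>.\<close>

definition stable_frame :: "'a set \<Rightarrow> ('a \<Rightarrow> 'a \<Rightarrow> real) \<Rightarrow> 'a list \<Rightarrow> bool" where
  "stable_frame X d F \<longleftrightarrow>
    (\<forall>j y z. 1 \<le> j \<and> j + 1 < length F \<and> y \<in> X \<and> z \<in> X \<and>
       between d (F ! (j - 1)) y (F ! j) \<and> between d (F ! j) z (F ! (j + 1)) \<longrightarrow>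
       \<not> strictly_between d y (F ! j) z)"

text \<open>The usual sufficient condition: \<open>F\<close> is its own frame and is shorter than every 4-cut.\<close>

definition four_cut :: "'a set \<Rightarrow> ('a \<Rightarrow> 'a \<Rightarrow> real) \<Rightarrow> 'a list \<Rightarrow> bool" where
  "four_cut X d x \<longleftrightarrow>
    x \<in> proper_chains X 3 \<and> smooth d x 1 \<and> smooth d x 2 \<and> d (x ! 0) (x ! 3) < chain_length d x"

lemma stable_frame_if_shorter_than_four_cuts:
  assumes "Metric_space X d" and "F \<in> proper_chains X n" and "frame d F = F"
    and cuts: "\<And>x. four_cut X d x \<Longrightarrow> chain_length d F < chain_length d x"
  shows "stable_frame X d F"
  unfolding stable_frame_def
proof (intro allI impI, elim conjE)
  interpret Metric_space X d by fact
  fix j y z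
  assume j: "1 \<le> j" "j + 1 < length F" and yz: "y \<in> X" "z \<in> X"
    and y: "between d (F ! (j - 1)) y (F ! j)" and z: "between d (F ! j) z (F ! (j + 1))"
  define a b c where abc: "a = F ! (j - 1)" "b = F ! j" "c = F ! (j + 1)"
  have X: "a \<in> X" "b \<in> X" "c \<in> X"
    using assms(2) j by (auto simp: abc proper_chains_def)
  have "i \<in> {1..<length F} \<Longrightarrow> F ! (i - 1) \<noteq> F ! i" for i
    using assms(2) by (auto simp: proper_chains_def)
  from this[of j] this[of "j + 1"] j have neq: "a \<noteq> b" "b \<noteq> c"
    by (auto simp: abc)
  have "card {i. i < length F \<and> i \<in> {i. \<not> smooth d F i}} = length F"
    using assms(3) by (metis frame_def length_nths)
  then have "{i. i < length F \<and> i \<in> {i. \<not> smooth d F i}} = {..<length F}"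
    by (intro card_subset_eq) auto
  moreover have "j \<in> {..<length F}"
    using j by simp
  ultimately have "\<not> smooth d F j"
    by blast
  then have sing: "d a b + d b c \<noteq> d a c"
    using j neq unfolding smooth_def strictly_between_def between_def abc by simp
  have "chain_length d F \<ge> (\<Sum>i\<in>{j, j + 1}. d (F ! (i - 1)) (F ! i))"
    unfolding chain_length_def using j by (intro sum_mono2) auto
  then have len: "d a b + d b c \<le> chain_length d F"
    by (simp add: abc)
  have no_cut: "d p s = d p q + d q r + d r s"
    if "p \<in> X" "q \<in> X" "r \<in> X" "s \<in> X" and neq: "p \<noteq> q" "q \<noteq> r" "r \<noteq> s"
      and e: "d p q + d q r = d p r" "d q r + d r s = d q s"
      and le: "d p q + d q r + d r s \<le> chain_length d F"
    for p q r s
  proof (rule ccontr)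
    assume "d p s \<noteq> d p q + d q r + d r s"
    with triangle[of p r s] that e have lt: "d p s < d p q + d q r + d r s"
      by linarith
    have ivl: "{1..<length [p, q, r, s]} = {1, 2, 3}"
      by auto
    have len: "chain_length d [p, q, r, s] = d p q + d q r + d r s"
      unfolding chain_length_def ivl by simp
    have "[p, q, r, s] \<in> proper_chains X 3"
      unfolding proper_chains_def mem_Collect_eq ivl using that by simp
    moreover have "smooth d [p, q, r, s] 1" "smooth d [p, q, r, s] 2"
      using neq e by (simp_all add: smooth_def strictly_between_def between_def)
    ultimately have "four_cut X d [p, q, r, s]"
      using lt unfolding four_cut_def len by simp
    from cuts[OF this] len le show False
      by linarith
  qed
  show "\<not> strictly_between d y (F ! j) z"
  proof
    assume "strictly_between d y (F ! j) z"
    then have s: "d y b + d b z = d y z" "y \<noteq> b" "b \<noteq> z"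
      by (simp_all add: strictly_between_def between_def abc)
    have e: "d a y + d y b = d a b" "d b z + d z c = d b c"
      using y z by (simp_all add: between_def abc)
    have nn: "0 \<le> d a y" "0 \<le> d z c"
      by simp_all
    have az: "d a b + d b z = d a z"
    proof (cases "a = y")
      case False
      have "d a z = d a y + d y b + d b z"
      proof (rule no_cut)
        show "d a y + d y b + d b z \<le> chain_length d F"
          using e nn len by linarith
      qed (use X yz s e False in simp_all)
      with e show ?thesis
        by linarith
    qed (use s in simp)
    have "d a c = d a b + d b c"
    proof (cases "z = c")
      case False
      have "d a c = d a b + d b z + d z c"
      proof (rule no_cut)
        show "d a b + d b z + d z c \<le> chain_length d F"
          using e nn len by linarith
      qed (use X yz s e az neq False in simp_all)
      with e show ?thesis
        by linarith
    qed (use az in simp)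
    with sing show False
      by simp
  qed
qed

end

theory Submission
  imports Defs
begin

text \<open>
  A chain \<open>x\<close> with frame \<open>F = (a\<^sub>0, \<dots>, a\<^sub>m)\<close> and length \<open>|F|\<close> visits the \<open>a\<^sub>h\<close> in order, and equality in
  the triangle inequality forces each segment from \<open>a\<^bsub>h-1\<^esub>\<close> to \<open>a\<^sub>h\<close> to be geodesic; the points inserted
  there form a simplex of \<open>I(a\<^bsub>h-1\<^esub>, a\<^sub>h)\<close>.  Conversely, gluing \<open>m\<close> simplices along \<open>F\<close> yields a chain in
  which the inserted points are smooth and, by stability, the points of \<open>F\<close> are singular.  Thus chains
  with frame \<open>F\<close> correspond to \<open>m\<close>-tuples of simplices, which form a basis of the total complex, since
  the tensor product of the groups \<open>\<int>[S\<^sub>h]\<close> is \<open>\<int>[S\<^sub>1 \<times> \<cdots> \<times> S\<^sub>m]\<close>.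

  If the simplices have degrees \<open>j\<^sub>1, \<dots>, j\<^sub>m\<close>, the \<open>k\<close>-th vertex of the \<open>h\<close>-th one sits at position
  \<open>h + \<Sum>\<^bsub>g<h\<^esub> (j\<^sub>g + 1) + k\<close>, which has the parity of \<open>1 + \<Sum>\<^bsub>g<h\<^esub> j\<^sub>g + k\<close>.  Hence the bijection anticommutes with the
  boundary operators, in every degree.
\<close>

text \<open>That the boundary of the total complex squares to zero is not computed with tensors. It
  is transported from the frame complex, where it reduces to the usual cancellation of pairs of
  omissions, because omitting a smooth point leaves the smooth or singular character of the others
  unchanged. The groups of the total complex consist of cosets in free groups on tuples of arbitrary
  chains. Multiplying such tuples out over the bases gives a complete invariant of the coset, so
  equalities of cosets are checked on expansions. The values in a glued list do not show which
  points come from \<open>F\<close>; the argument therefore works with positions: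
  \<open>F ! h\<close> stands at the end of the prefix glued from the first \<open>h\<close>
  simplices. The shift by 2m counts points: \<open>F\<close> has \<open>m + 1\<close> of them, and
  each of the \<open>m\<close> simplices has one more than its degree, so a cell of degree j gives a
  chain with j + 2m + 1 points, which has degree j + 2m.\<close>

declare One_nat_def [simp del]

section \<open>Free abelian groups\<close>

lemma frag_extend_frag_extend:
  fixes f :: "'b \<Rightarrow> 'a \<Rightarrow>\<^sub>0 int"
  shows "frag_extend f (frag_extend g c) = frag_extend (\<lambda>x. frag_extend f (g x)) c"
  unfolding frag_extend_def[of g]
  by (simp add: frag_extend_sum frag_extend_cmul o_def frag_extend_def[of "\<lambda>x. frag_extend f (g x)"])

lemma keys_frag_extend_subset:
  fixes f :: "'b \<Rightarrow> 'a \<Rightarrow>\<^sub>0 int"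
  assumes "Poly_Mapping.keys c \<subseteq> S" and "\<And>x. x \<in> S \<Longrightarrow> Poly_Mapping.keys (f x) \<subseteq> T"
  shows "Poly_Mapping.keys (frag_extend f c) \<subseteq> T"
  using keys_frag_extend[of f c] assms by blast

lemma keys_sum_subset:
  fixes f :: "'b \<Rightarrow> 'a \<Rightarrow>\<^sub>0 int"
  shows "(\<And>i. i \<in> I \<Longrightarrow> Poly_Mapping.keys (f i) \<subseteq> T) \<Longrightarrow> Poly_Mapping.keys (sum f I) \<subseteq> T"
  using sum_closed_free_Abelian_group[of I f T] by simp

lemma keys_frag_cmul_subset:
  "Poly_Mapping.keys c \<subseteq> T \<Longrightarrow> Poly_Mapping.keys (frag_cmul k c) \<subseteq> T"
  by auto

lemma frag_extend_hom:
  assumes "\<And>x. x \<in> S \<Longrightarrow> Poly_Mapping.keys (f x) \<subseteq> T"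
  shows "frag_extend f \<in> hom (free_Abelian_group S) (free_Abelian_group T)"
proof (rule homI)
  fix x
  assume "x \<in> carrier (free_Abelian_group S)"
  then show "frag_extend f x \<in> carrier (free_Abelian_group T)"
    using keys_frag_extend_subset[of x S f T] assms by simp
qed (simp add: frag_extend_add)

lemma frag_extend_uminus: "frag_extend (\<lambda>x. - f x) c = - frag_extend f c"
  using subset_UNIV[of "Poly_Mapping.keys c"]
  by (induction c rule: frag_induction) (simp_all add: frag_extend_diff)

section \<open>Tensor products of free abelian groups\<close>

definition tensor_class ::
  "'i set \<Rightarrow> ('i \<Rightarrow> 'g monoid) \<Rightarrow> (('i \<Rightarrow> 'g) \<Rightarrow>\<^sub>0 int) \<Rightarrow> (('i \<Rightarrow> 'g) \<Rightarrow>\<^sub>0 int) set" where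
  "tensor_class I A c = tensor_null I A #>\<^bsub>free_Abelian_group (\<Pi>\<^sub>E i\<in>I. carrier (A i))\<^esub> c"

lemma mem_tensor_class: "x \<in> tensor_class I A c \<longleftrightarrow> x - c \<in> tensor_null I A"
proof -
  have "(\<exists>h\<in>tensor_null I A. x = h + c) \<longleftrightarrow> x - c \<in> tensor_null I A"
    by (auto intro: bexI[of _ "x - c"])
  then show ?thesis
    by (simp add: tensor_class_def r_coset_def)
qed

lemma tensor_null_0: "0 \<in> tensor_null I A"
  unfolding tensor_null_def
  using generate.one[of "free_Abelian_group (\<Pi>\<^sub>E i\<in>I. carrier (A i))"] by simp

lemma tensor_null_add:
  "x \<in> tensor_null I A \<Longrightarrow> y \<in> tensor_null I A \<Longrightarrow> x + y \<in> tensor_null I A"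
  unfolding tensor_null_def
  using generate.eng[of x "free_Abelian_group (\<Pi>\<^sub>E i\<in>I. carrier (A i))"] by simp

lemma tensor_null_relator:
  assumes "x \<in> (\<Pi>\<^sub>E i\<in>I. carrier (A i))" "h \<in> I" "u \<in> carrier (A h)" "v \<in> carrier (A h)"
  shows "frag_of (x(h := u \<otimes>\<^bsub>A h\<^esub> v)) - frag_of (x(h := u)) - frag_of (x(h := v))
    \<in> tensor_null I A"
  unfolding tensor_null_def
  by (rule generate.incl) (use assms in \<open>auto simp: tensor_relators_def\<close>)

locale abelian_family =
  fixes I :: "'i set" and A :: "'i \<Rightarrow> 'g monoid"
  assumes comm_group: "i \<in> I \<Longrightarrow> comm_group (A i)"
begin

abbreviation tuple_group where
  "tuple_group \<equiv> free_Abelian_group (\<Pi>\<^sub>E i\<in>I. carrier (A i))"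

lemma tensor_relators_closed:
  assumes "r \<in> tensor_relators I A"
  shows "Poly_Mapping.keys r \<subseteq> (\<Pi>\<^sub>E i\<in>I. carrier (A i))"
proof -
  obtain x h u v where r: "r = frag_of (x(h := u \<otimes>\<^bsub>A h\<^esub> v)) - frag_of (x(h := u)) - frag_of (x(h := v))"
    and x: "x \<in> (\<Pi>\<^sub>E i\<in>I. carrier (A i))" and h: "h \<in> I" "u \<in> carrier (A h)" "v \<in> carrier (A h)"
    using assms unfolding tensor_relators_def by blast
  interpret Ah: comm_group "A h"
    using h comm_group by blast
  have upd: "x(h := w) \<in> (\<Pi>\<^sub>E i\<in>I. carrier (A i))" if "w \<in> carrier (A h)" for w
    using x h that by (auto simp: PiE_iff extensional_def)
  have "frag_of (x(h := u \<otimes>\<^bsub>A h\<^esub> v)) \<in> carrier tuple_group"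
    "frag_of (x(h := u)) \<in> carrier tuple_group" "frag_of (x(h := v)) \<in> carrier tuple_group"
    using h upd by simp_all
  then show ?thesis
    unfolding r by (meson Un_least carrier_free_Abelian_group_iff keys_diff order_trans)
qed

lemma subgroup_tensor_null: "subgroup (tensor_null I A) tuple_group"
  unfolding tensor_null_def
  by (rule group.generate_is_subgroup) (use tensor_relators_closed in auto)

lemma tensor_null_closed:
  "x \<in> tensor_null I A \<Longrightarrow> Poly_Mapping.keys x \<subseteq> (\<Pi>\<^sub>E i\<in>I. carrier (A i))"
  using subgroup.mem_carrier[OF subgroup_tensor_null] by simp

lemma tensor_null_minus: "x \<in> tensor_null I A \<Longrightarrow> - x \<in> tensor_null I A"
  using subgroup.m_inv_closed[OF subgroup_tensor_null] tensor_null_closed by fastforce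

lemma tensor_null_diff:
  "x \<in> tensor_null I A \<Longrightarrow> y \<in> tensor_null I A \<Longrightarrow> x - y \<in> tensor_null I A"
  using tensor_null_add[OF _ tensor_null_minus] by fastforce

lemma tensor_null_induct [consumes 1, case_names zero relator minus add]:
  assumes "x \<in> tensor_null I A" and "P 0" and "\<And>r. r \<in> tensor_relators I A \<Longrightarrow> P r"
    and "\<And>r. P r \<Longrightarrow> P (- r)" and "\<And>x y. P x \<Longrightarrow> P y \<Longrightarrow> P (x + y)"
  shows "P x"
  using assms(1) unfolding tensor_null_def
  by (induction rule: generate.induct) (use assms tensor_relators_closed in auto)

lemma tensor_class_eq_iff: "tensor_class I A c = tensor_class I A c' \<longleftrightarrow> c - c' \<in> tensor_null I A"
proof
  assume "tensor_class I A c = tensor_class I A c'"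
  moreover have "c \<in> tensor_class I A c"
    by (simp add: mem_tensor_class tensor_null_0)
  ultimately show "c - c' \<in> tensor_null I A"
    by (simp add: mem_tensor_class)
next
  assume *: "c - c' \<in> tensor_null I A"
  have "x - c \<in> tensor_null I A \<longleftrightarrow> x - c' \<in> tensor_null I A" for x
    using tensor_null_add[OF _ *, of "x - c"] tensor_null_diff[OF _ *, of "x - c'"] by auto
  then show "tensor_class I A c = tensor_class I A c'"
    by (auto simp: mem_tensor_class)
qed

lemma comm_group_tensor_product: "comm_group (tensor_product I A)"
  unfolding tensor_product_def
  by (rule comm_group.abelian_FactGroup[OF abelian_free_Abelian_group subgroup_tensor_null])

lemma carrier_tensor_product: "carrier (tensor_product I A) = tensor_class I A ` carrier tuple_group"
  unfolding tensor_product_def tensor_class_def by (simp add: carrier_FactGroup)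

lemma one_tensor_product: "\<one>\<^bsub>tensor_product I A\<^esub> = tensor_class I A 0"
  unfolding tensor_product_def by (auto simp: mem_tensor_class)

lemma tensor_class_closed:
  "Poly_Mapping.keys c \<subseteq> (\<Pi>\<^sub>E i\<in>I. carrier (A i)) \<Longrightarrow>
    tensor_class I A c \<in> carrier (tensor_product I A)"
  by (simp add: carrier_tensor_product)

lemma tensor_class_add:
  assumes "Poly_Mapping.keys c \<subseteq> (\<Pi>\<^sub>E i\<in>I. carrier (A i))"
    and "Poly_Mapping.keys c' \<subseteq> (\<Pi>\<^sub>E i\<in>I. carrier (A i))"
  shows "tensor_class I A (c + c') =
    tensor_class I A c \<otimes>\<^bsub>tensor_product I A\<^esub> tensor_class I A c'"
proof -
  have "tensor_null I A \<lhd> tuple_group"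
    using comm_group.subgroup_imp_normal[OF abelian_free_Abelian_group subgroup_tensor_null] .
  from normal.rcos_sum[OF this, of c c'] assms show ?thesis
    by (simp add: tensor_product_def tensor_class_def)
qed

lemma tensor_class_minus:
  assumes "Poly_Mapping.keys c \<subseteq> (\<Pi>\<^sub>E i\<in>I. carrier (A i))"
  shows "tensor_class I A (- c) = inv\<^bsub>tensor_product I A\<^esub> tensor_class I A c"
proof -
  interpret T: comm_group "tensor_product I A"
    by (rule comm_group_tensor_product)
  have "tensor_class I A (- c) \<otimes>\<^bsub>tensor_product I A\<^esub> tensor_class I A c = \<one>\<^bsub>tensor_product I A\<^esub>"
    using tensor_class_add[of "- c" c] assms by (simp add: one_tensor_product)
  then show ?thesis
    using assms by (intro T.inv_equality[symmetric] tensor_class_closed) simp_all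
qed

text \<open>The boundary of the total complex is a product in a tensor group. This turns it into the
  class of a single sum of representatives, on which one can compute.\<close>

lemma finprod_tensor_class:
  assumes "finite H" "\<And>h. h \<in> H \<Longrightarrow> Poly_Mapping.keys (c h) \<subseteq> (\<Pi>\<^sub>E i\<in>I. carrier (A i))"
  shows "(\<Otimes>\<^bsub>tensor_product I A\<^esub>h\<in>H. tensor_class I A (c h)) = tensor_class I A (\<Sum>h\<in>H. c h)"
  using assms
proof (induction H rule: finite_induct)
  interpret T: comm_group "tensor_product I A"
    by (rule comm_group_tensor_product)
  {
    case empty
    then show ?case
      by (simp add: one_tensor_product)
  next
    case (insert h H)
    then have "(\<lambda>h. tensor_class I A (c h)) \<in> H \<rightarrow> carrier (tensor_product I A)"
      by (auto intro!: tensor_class_closed)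
    moreover have "Poly_Mapping.keys (sum c H) \<subseteq> (\<Pi>\<^sub>E i\<in>I. carrier (A i))"
      using insert.prems by (intro keys_sum_subset) auto
    ultimately show ?case
      using insert by (simp add: tensor_class_add tensor_class_closed)
  }
qed

end

section \<open>Induced maps of tensor products\<close>

locale abelian_family_hom =
  A: abelian_family I A + B: abelian_family I B
  for I :: "'i set" and A :: "'i \<Rightarrow> 'g monoid" and B :: "'i \<Rightarrow> 'h monoid" +
  fixes f :: "'i \<Rightarrow> 'g \<Rightarrow> 'h"
  assumes hom: "i \<in> I \<Longrightarrow> f i \<in> hom (A i) (B i)"
begin

abbreviation tuple_map where
  "tuple_map \<equiv> frag_extend (\<lambda>x. frag_of (\<lambda>i\<in>I. f i (x i)))"

lemma tuple_map_closed:
  assumes "Poly_Mapping.keys c \<subseteq> (\<Pi>\<^sub>E i\<in>I. carrier (A i))"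
  shows "Poly_Mapping.keys (tuple_map c) \<subseteq> (\<Pi>\<^sub>E i\<in>I. carrier (B i))"
  using assms hom by (intro keys_frag_extend_subset) (auto simp: hom_def Pi_iff PiE_iff)

text \<open>Well-definedness of the induced map. Applying the homomorphisms coordinatewise commutes
  with changing one coordinate, so a relator goes to the relator formed from the images of
  \<open>u\<close> and \<open>v\<close>.\<close>

lemma tuple_map_tensor_null:
  assumes "c \<in> tensor_null I A"
  shows "tuple_map c \<in> tensor_null I B"
  using assms
proof (induction rule: A.tensor_null_induct)
  case zero
  then show ?case
    by (simp add: tensor_null_0)
next
  case (relator r)
  then obtain x h u v where r: "r = frag_of (x(h := u \<otimes>\<^bsub>A h\<^esub> v)) - frag_of (x(h := u)) - frag_of (x(h := v))"
    and x: "x \<in> (\<Pi>\<^sub>E i\<in>I. carrier (A i))" and h: "h \<in> I" "u \<in> carrier (A h)" "v \<in> carrier (A h)"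
    unfolding tensor_relators_def by blast
  have upd: "(\<lambda>i\<in>I. f i ((x(h := w)) i)) = (\<lambda>i\<in>I. f i (x i))(h := f h w)" for w
    using h by auto
  have "(\<lambda>i\<in>I. f i (x i)) \<in> (\<Pi>\<^sub>E i\<in>I. carrier (B i))"
    using hom x by (auto simp: hom_def Pi_iff PiE_iff)
  from tensor_null_relator[where A = B, OF this, of h "f h u" "f h v"] show ?case
    using hom[of h] h unfolding r frag_extend_diff frag_extend_of upd
    by (auto simp: hom_def Pi_iff)
next
  case (minus r)
  then show ?case
    by (simp add: frag_extend_minus B.tensor_null_minus)
next
  case (add x y)
  then show ?case
    by (simp add: frag_extend_add tensor_null_add)
qed

text \<open>Representatives of one coset have images in one coset, so the set inside
  \<open>the_elem\<close> is a singleton.\<close>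

lemma tensor_map_tensor_class:
  "tensor_map I B f (tensor_class I A c) = tensor_class I B (tuple_map c)"
proof -
  have "tensor_class I B (tuple_map x) = tensor_class I B (tuple_map c)"
    if "x \<in> tensor_class I A c" for x
    using tuple_map_tensor_null that
    by (simp add: B.tensor_class_eq_iff mem_tensor_class flip: frag_extend_diff)
  moreover have "c \<in> tensor_class I A c"
    by (simp add: mem_tensor_class tensor_null_0)
  ultimately have "(\<lambda>x. tensor_class I B (tuple_map x)) ` tensor_class I A c =
      {tensor_class I B (tuple_map c)}"
    by blast
  then show ?thesis
    unfolding tensor_map_def tensor_class_def by simp
qed

end

section \<open>Multiplying out tensors over bases\<close>

definition multilinear_expansion :: "'i set \<Rightarrow> ('i \<Rightarrow> ('b \<Rightarrow>\<^sub>0 int)) \<Rightarrow> ('i \<Rightarrow> 'b) \<Rightarrow>\<^sub>0 int" where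
  "multilinear_expansion I x =
    (\<Sum>s \<in> (\<Pi>\<^sub>E i\<in>I. Poly_Mapping.keys (x i)).
      frag_cmul (\<Prod>i\<in>I. Poly_Mapping.lookup (x i) (s i)) (frag_of s))"

text \<open>The two directions between tuples of chains and tuples of basis elements:
  \<open>expand\<close> multiplies out, and \<open>pure\<close> reads a tuple of basis elements as a
  tuple of one-term chains.\<close>

abbreviation "expand I \<equiv> frag_extend (multilinear_expansion I)"

abbreviation "pure I \<equiv> frag_extend (\<lambda>s. frag_of (\<lambda>i\<in>I. frag_of (s i)))"

locale free_family =
  fixes I :: "'i set" and S :: "'i \<Rightarrow> 'b set"
  assumes finite_index: "finite I"

sublocale free_family \<subseteq> abelian_family I "\<lambda>i. free_Abelian_group (S i)"
  by (rule abelian_family.intro) (rule abelian_free_Abelian_group)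

context free_family
begin

text \<open>The supports, which keep the defining sum finite, drop out of the coefficient: outside
  of them some factor vanishes. With this closed formula, additivity in a coordinate is
  distributivity for one factor of a product.\<close>

lemma lookup_multilinear_expansion:
  "Poly_Mapping.lookup (multilinear_expansion I x) s =
    (if s \<in> extensional I then \<Prod>i\<in>I. Poly_Mapping.lookup (x i) (s i) else 0)"
proof -
  let ?K = "\<Pi>\<^sub>E i\<in>I. Poly_Mapping.keys (x i)"
  have "finite ?K"
    using finite_index by (intro finite_PiE) auto
  have "Poly_Mapping.lookup (multilinear_expansion I x) s =
      (\<Sum>t\<in>?K. if t = s then \<Prod>i\<in>I. Poly_Mapping.lookup (x i) (t i) else 0)"
    unfolding multilinear_expansion_def lookup_sum by (rule sum.cong) auto
  then have "Poly_Mapping.lookup (multilinear_expansion I x) s =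
      (if s \<in> ?K then \<Prod>i\<in>I. Poly_Mapping.lookup (x i) (s i) else 0)"
    using \<open>finite ?K\<close> by (simp only: sum.delta)
  moreover have "(\<Prod>i\<in>I. Poly_Mapping.lookup (x i) (s i)) = 0"
    if s: "s \<notin> ?K" "s \<in> extensional I"
  proof -
    obtain i where "i \<in> I" "s i \<notin> Poly_Mapping.keys (x i)"
      using s unfolding PiE_iff by blast
    then show ?thesis
      using finite_index by (intro prod_zero bexI[of _ i]) (simp_all add: in_keys_iff)
  qed
  moreover have "s \<in> extensional I" if "s \<in> ?K"
    using that by (simp add: PiE_iff)
  ultimately show ?thesis
    by presburger
qed

lemma multilinear_expansion_add:
  assumes "h \<in> I"
  shows "multilinear_expansion I (x(h := u + v)) =
    multilinear_expansion I (x(h := u)) + multilinear_expansion I (x(h := v))"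
proof (rule poly_mapping_eqI)
  fix s
  have "(\<Prod>i\<in>I. Poly_Mapping.lookup ((x(h := w)) i) (s i)) =
      Poly_Mapping.lookup w (s h) * (\<Prod>i\<in>I - {h}. Poly_Mapping.lookup (x i) (s i))" for w
    using assms finite_index by (subst prod.remove[of I h]) auto
  then show "Poly_Mapping.lookup (multilinear_expansion I (x(h := u + v))) s =
      Poly_Mapping.lookup (multilinear_expansion I (x(h := u)) + multilinear_expansion I (x(h := v))) s"
    by (simp add: lookup_multilinear_expansion lookup_add ring_distribs del: fun_upd_apply)
qed

lemma multilinear_expansion_0: "h \<in> I \<Longrightarrow> multilinear_expansion I (x(h := 0)) = 0"
  using multilinear_expansion_add[of h x 0 0] by simp

lemma multilinear_expansion_diff:
  assumes "h \<in> I"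
  shows "multilinear_expansion I (x(h := u - v)) =
    multilinear_expansion I (x(h := u)) - multilinear_expansion I (x(h := v))"
  using multilinear_expansion_add[OF assms, of x "u - v" v] by (simp add: algebra_simps)

lemma multilinear_expansion_frag_of:
  assumes "s \<in> extensional I" and "\<And>i. i \<in> I \<Longrightarrow> x i = frag_of (s i)"
  shows "multilinear_expansion I x = frag_of s"
proof (rule poly_mapping_eqI)
  fix t
  show "Poly_Mapping.lookup (multilinear_expansion I x) t = Poly_Mapping.lookup (frag_of s) t"
  proof (cases "t = s")
    case True
    then show ?thesis
      using assms by (simp add: lookup_multilinear_expansion)
  next
    case False
    then have "\<exists>i\<in>I. t i \<noteq> s i" if "t \<in> extensional I"
      using assms(1) that extensionalityI[of t I s] by blast
    then show ?thesis
      using False assms finite_index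
      by (auto simp: lookup_multilinear_expansion prod_zero_iff)
  qed
qed

lemma multilinear_expansion_closed:
  assumes "x \<in> (\<Pi>\<^sub>E i\<in>I. carrier (free_Abelian_group (S i)))"
  shows "Poly_Mapping.keys (multilinear_expansion I x) \<subseteq> (\<Pi>\<^sub>E i\<in>I. S i)"
  unfolding multilinear_expansion_def
proof (rule keys_sum_subset)
  fix s
  assume "s \<in> (\<Pi>\<^sub>E i\<in>I. Poly_Mapping.keys (x i))"
  moreover have "(\<Pi>\<^sub>E i\<in>I. Poly_Mapping.keys (x i)) \<subseteq> (\<Pi>\<^sub>E i\<in>I. S i)"
    using assms by (intro PiE_mono) (simp add: PiE_iff)
  ultimately have "s \<in> (\<Pi>\<^sub>E i\<in>I. S i)"
    by blast
  then show "Poly_Mapping.keys (frag_cmul (\<Prod>i\<in>I. Poly_Mapping.lookup (x i) (s i)) (frag_of s)) \<subseteq> (\<Pi>\<^sub>E i\<in>I. S i)"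
    by (intro keys_frag_cmul_subset) simp
qed

text \<open>This is the shape that the tensor boundary produces: slot \<open>h\<close> holds a
  boundary and the other slots hold basis elements. Linearity in slot \<open>h\<close> leaves the
  case of a basis element there.\<close>

lemma multilinear_expansion_upd_frag_extend:
  assumes "h \<in> I" "s \<in> extensional I"
  shows "multilinear_expansion I (\<lambda>i\<in>I. if i = h then v else frag_of (s i)) =
    frag_extend (\<lambda>u. frag_of (s(h := u))) v"
proof -
  let ?x = "\<lambda>i\<in>I. frag_of (s i)"
  have "multilinear_expansion I (?x(h := v)) = frag_extend (\<lambda>u. frag_of (s(h := u))) v"
    using subset_UNIV[of "Poly_Mapping.keys v"]
  proof (induction v rule: frag_induction)
    case (one u)
    have "multilinear_expansion I (?x(h := frag_of u)) = frag_of (s(h := u))"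
      using assms by (intro multilinear_expansion_frag_of) (simp_all add: extensional_def)
    then show ?case
      by (simp only: frag_extend_of)
  qed (use assms in \<open>simp_all add: multilinear_expansion_0 multilinear_expansion_diff frag_extend_diff
      del: fun_upd_apply restrict_apply\<close>)
  moreover have "(\<lambda>i\<in>I. if i = h then v else frag_of (s i)) = ?x(h := v)"
    using assms by auto
  ultimately show ?thesis
    by simp
qed

lemma expand_closed:
  "Poly_Mapping.keys c \<subseteq> (\<Pi>\<^sub>E i\<in>I. carrier (free_Abelian_group (S i))) \<Longrightarrow>
    Poly_Mapping.keys (expand I c) \<subseteq> (\<Pi>\<^sub>E i\<in>I. S i)"
  by (rule keys_frag_extend_subset) (use multilinear_expansion_closed in blast)+

lemma pure_closed:
  "Poly_Mapping.keys c \<subseteq> (\<Pi>\<^sub>E i\<in>I. S i) \<Longrightarrow>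
    Poly_Mapping.keys (pure I c) \<subseteq> (\<Pi>\<^sub>E i\<in>I. carrier (free_Abelian_group (S i)))"
  by (rule keys_frag_extend_subset) auto

lemma expand_pure:
  assumes "Poly_Mapping.keys c \<subseteq> (\<Pi>\<^sub>E i\<in>I. S i)"
  shows "expand I (pure I c) = c"
proof -
  have "expand I (pure I c) = frag_extend frag_of c"
    unfolding frag_extend_frag_extend frag_extend_of
    using assms by (intro frag_extend_eq multilinear_expansion_frag_of) (auto simp: PiE_iff)
  then show ?thesis
    using frag_expansion[of c] by simp
qed

lemma expand_tensor_null:
  assumes "c \<in> tensor_null I (\<lambda>i. free_Abelian_group (S i))"
  shows "expand I c = 0"
  using assms
proof (induction rule: tensor_null_induct)
  case (relator r)
  then show ?case
    unfolding tensor_relators_def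
    by (auto simp: frag_extend_diff multilinear_expansion_add)
qed (auto simp: frag_extend_minus frag_extend_add)

text \<open>A tuple is equivalent to its expansion modulo the relators. \<open>K\<close> contains
  the coordinates that may still be arbitrary chains. One of them is built up from basis elements by
  differences, each at the cost of one relator; once it is a basis element, it leaves
  \<open>K\<close>.\<close>

lemma frag_of_minus_pure_expansion_aux:
  assumes "finite K" "K \<subseteq> I" "x \<in> (\<Pi>\<^sub>E i\<in>I. carrier (free_Abelian_group (S i)))"
    and "\<And>i. i \<in> I - K \<Longrightarrow> x i \<in> frag_of ` S i"
  shows "frag_of x - pure I (multilinear_expansion I x)
    \<in> tensor_null I (\<lambda>i. free_Abelian_group (S i))"
  using assms
proof (induction K arbitrary: x rule: finite_induct)
  case empty
  then have "\<forall>i\<in>I. \<exists>s. s \<in> S i \<and> x i = frag_of s"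
    by blast
  then obtain s where s: "\<And>i. i \<in> I \<Longrightarrow> s i \<in> S i \<and> x i = frag_of (s i)"
    by metis
  have "multilinear_expansion I x = frag_of (restrict s I)"
    using s by (intro multilinear_expansion_frag_of) auto
  moreover have "(\<lambda>i\<in>I. frag_of (restrict s I i)) = x"
    using s empty.prems by (auto simp: PiE_iff extensional_def)
  ultimately show ?case
    by (simp add: tensor_null_0 del: restrict_apply)
next
  case (insert k K)
  let ?N = "tensor_null I (\<lambda>i. free_Abelian_group (S i))"
  let ?D = "\<lambda>w. frag_of (x(k := w)) - pure I (multilinear_expansion I (x(k := w)))"
  have k: "k \<in> I"
    using insert.prems by simp
  have rel: "frag_of (x(k := u + v)) - frag_of (x(k := u)) - frag_of (x(k := v)) \<in> ?N"
    if "Poly_Mapping.keys u \<subseteq> S k" "Poly_Mapping.keys v \<subseteq> S k" for u v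
    using tensor_null_relator[OF insert.prems(2) k, of u v] that by simp
  have "?D w \<in> ?N" if "Poly_Mapping.keys w \<subseteq> S k" for w
    using that
  proof (induction w rule: free_Abelian_group_induct[consumes 1, case_names zero diff one])
    case zero
    then show ?case
      \<comment> \<open>For \<open>u = v = 0\<close> the relator collapses to the negative of
        \<open>frag_of (x(k := 0))\<close>, and the expansion of this tuple is zero.\<close>
      using tensor_null_minus[OF rel[of 0 0]]
      by (simp add: multilinear_expansion_0[OF k] del: restrict_apply fun_upd_apply)
  next
    case (diff u v)
    have "Poly_Mapping.keys (u - v) \<subseteq> S k"
      using diff keys_diff[of u v] by blast
    \<comment> \<open>The relator for the decomposition of \<open>u\<close> as
      \<open>(u - v) + v\<close> replaces the difference of the two tuples by the tuple with
      \<open>u - v\<close>.\<close>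
    then have "?D u - ?D v - (frag_of (x(k := (u - v) + v)) - frag_of (x(k := u - v)) - frag_of (x(k := v))) \<in> ?N"
      by (rule tensor_null_diff[OF tensor_null_diff[OF diff(3,4)] rel[OF _ diff(2)]])
    then show ?case
      by (simp add: multilinear_expansion_diff[OF k] frag_extend_diff algebra_simps
          del: restrict_apply fun_upd_apply)
  next
    case (one a)
    show ?case
    proof (rule insert.IH)
      show "x(k := frag_of a) \<in> (\<Pi>\<^sub>E i\<in>I. carrier (free_Abelian_group (S i)))"
        using insert.prems k one by (auto simp: PiE_iff extensional_def)
    qed (use insert.prems one in auto)
  qed
  from this[of "x k"] show ?case
    using insert.prems(2) k by (simp add: PiE_iff del: restrict_apply fun_upd_apply)
qed

lemma minus_pure_expand_tensor_null:
  assumes "Poly_Mapping.keys c \<subseteq> (\<Pi>\<^sub>E i\<in>I. carrier (free_Abelian_group (S i)))"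
  shows "c - pure I (expand I c) \<in> tensor_null I (\<lambda>i. free_Abelian_group (S i))"
  using assms
proof (induction c rule: frag_induction)
  case zero
  then show ?case
    by (simp add: tensor_null_0)
next
  case (one x)
  then show ?case
    using frag_of_minus_pure_expansion_aux[of I x] finite_index by (simp del: restrict_apply)
next
  case (diff a b)
  from tensor_null_diff[OF this] show ?case
    by (simp add: frag_extend_diff algebra_simps)
qed

text \<open>So \<open>expand I\<close> identifies the tensor product of the groups \<open>\<int>[S i]\<close> with \<open>\<int>[\<Pi> S i]\<close>.\<close>

lemma tensor_class_eq_iff_expand:
  assumes "Poly_Mapping.keys c \<subseteq> (\<Pi>\<^sub>E i\<in>I. carrier (free_Abelian_group (S i)))"
    and "Poly_Mapping.keys c' \<subseteq> (\<Pi>\<^sub>E i\<in>I. carrier (free_Abelian_group (S i)))"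
  shows "tensor_class I (\<lambda>i. free_Abelian_group (S i)) c =
      tensor_class I (\<lambda>i. free_Abelian_group (S i)) c' \<longleftrightarrow> expand I c = expand I c'"
proof
  assume "tensor_class I (\<lambda>i. free_Abelian_group (S i)) c = tensor_class I (\<lambda>i. free_Abelian_group (S i)) c'"
  then show "expand I c = expand I c'"
    using expand_tensor_null[of "c - c'"] by (simp add: tensor_class_eq_iff frag_extend_diff)
next
  assume eq: "expand I c = expand I c'"
  show "tensor_class I (\<lambda>i. free_Abelian_group (S i)) c = tensor_class I (\<lambda>i. free_Abelian_group (S i)) c'"
    using tensor_null_diff[OF minus_pure_expand_tensor_null[OF assms(1)] minus_pure_expand_tensor_null[OF assms(2)]]
    by (simp add: tensor_class_eq_iff eq)
qed

end

section \<open>Total complexes of complexes with bases\<close>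

text \<open>\<open>deg\<close> reads the degree off a basis element, so a tuple of basis elements
  determines its multidegree and the summands of the total complex can be told apart on the
  basis.\<close>

locale based_complexes =
  fixes m :: nat and S :: "nat \<Rightarrow> int \<Rightarrow> 'b set" and deg :: "'b \<Rightarrow> int"
    and \<delta> :: "nat \<Rightarrow> 'b \<Rightarrow> ('b \<Rightarrow>\<^sub>0 int)"
  assumes deg: "s \<in> S h n \<Longrightarrow> deg s = n"
    and boundary_closed: "s \<in> S h n \<Longrightarrow> Poly_Mapping.keys (\<delta> h s) \<subseteq> S h (n - 1)"
begin

definition based_complex :: "nat \<Rightarrow> ('b \<Rightarrow>\<^sub>0 int) graded_complex" where
  "based_complex h = \<lparr>grp = (\<lambda>n. free_Abelian_group (S h n)), bdry = (\<lambda>n. frag_extend (\<delta> h))\<rparr>"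

definition cells :: "int \<Rightarrow> (nat \<Rightarrow> 'b) set" where
  "cells n = (\<Union>i\<in>multidegrees m n. \<Pi>\<^sub>E h\<in>{1..m}. S h (i h))"

definition mdeg :: "(nat \<Rightarrow> 'b) \<Rightarrow> nat \<Rightarrow> int" where
  "mdeg s = (\<lambda>h\<in>{1..m}. deg (s h))"

definition component :: "(nat \<Rightarrow> int) \<Rightarrow> ((nat \<Rightarrow> 'b) \<Rightarrow>\<^sub>0 int) \<Rightarrow> (nat \<Rightarrow> 'b) \<Rightarrow>\<^sub>0 int" where
  "component i = frag_extend (\<lambda>s. if mdeg s = i then frag_of s else 0)"

definition koszul_sign :: "(nat \<Rightarrow> int) \<Rightarrow> nat \<Rightarrow> int" where
  "koszul_sign i h = (if even (\<Sum>g = 1..<h. i g) then 1 else - 1)"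

text \<open>The boundary of the total complex in the basis of cells, with the signs taken from the
  multidegree of the source.\<close>

definition cell_boundary :: "(nat \<Rightarrow> 'b) \<Rightarrow> (nat \<Rightarrow> 'b) \<Rightarrow>\<^sub>0 int" where
  "cell_boundary s = (\<Sum>h = 1..m. frag_cmul (koszul_sign (mdeg s) h)
     (frag_extend (\<lambda>u. frag_of (s(h := u))) (\<delta> h (s h))))"

abbreviation tensor :: "(nat \<Rightarrow> int) \<Rightarrow> ((nat \<Rightarrow> ('b \<Rightarrow>\<^sub>0 int)) \<Rightarrow>\<^sub>0 int) set monoid" where
  "tensor i \<equiv> tensor_product {1..m} (\<lambda>h. free_Abelian_group (S h (i h)))"

abbreviation tclass :: "(nat \<Rightarrow> int) \<Rightarrow> ((nat \<Rightarrow> ('b \<Rightarrow>\<^sub>0 int)) \<Rightarrow>\<^sub>0 int) \<Rightarrow> ((nat \<Rightarrow> ('b \<Rightarrow>\<^sub>0 int)) \<Rightarrow>\<^sub>0 int) set" where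
  "tclass i \<equiv> tensor_class {1..m} (\<lambda>h. free_Abelian_group (S h (i h)))"

text \<open>A combination of cells is sorted by multidegree, and each part becomes a class in the
  tensor product of that multidegree.\<close>

definition cells_to_total ::
  "int \<Rightarrow> ((nat \<Rightarrow> 'b) \<Rightarrow>\<^sub>0 int) \<Rightarrow> (nat \<Rightarrow> int) \<Rightarrow> ((nat \<Rightarrow> ('b \<Rightarrow>\<^sub>0 int)) \<Rightarrow>\<^sub>0 int) set" where
  "cells_to_total n c = (\<lambda>i\<in>multidegrees m n. tclass i (pure {1..m} (component i c)))"

sublocale F: free_family "{1..m}" "\<lambda>h. S h (i h)" for i
  by unfold_locales simp

lemma mdeg_eq:
  assumes "s \<in> (\<Pi>\<^sub>E h\<in>{1..m}. S h (i h))" "i \<in> multidegrees m n"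
  shows "mdeg s = i"
  using assms deg by (fastforce simp: mdeg_def multidegrees_def PiE_iff extensional_def fun_eq_iff)

lemma mem_cells: "s \<in> cells n \<longleftrightarrow> mdeg s \<in> multidegrees m n \<and> s \<in> (\<Pi>\<^sub>E h\<in>{1..m}. S h (mdeg s h))"
proof
  assume "s \<in> cells n"
  then obtain i where "i \<in> multidegrees m n" "s \<in> (\<Pi>\<^sub>E h\<in>{1..m}. S h (i h))"
    unfolding cells_def by blast
  then show "mdeg s \<in> multidegrees m n \<and> s \<in> (\<Pi>\<^sub>E h\<in>{1..m}. S h (mdeg s h))"
    using mdeg_eq by simp
qed (auto simp: cells_def)

lemma component_of_homogeneous:
  assumes "Poly_Mapping.keys b \<subseteq> (\<Pi>\<^sub>E h\<in>{1..m}. S h (j h))" "j \<in> multidegrees m n"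
  shows "component i b = (if j = i then b else 0)"
proof -
  have "mdeg s = j" if "s \<in> Poly_Mapping.keys b" for s
    using assms that mdeg_eq by blast
  then show ?thesis
    unfolding component_def
    using frag_expansion[of b] by (auto intro: frag_extend_eq_0 cong: frag_extend_eq)
qed

lemma component_closed:
  assumes "Poly_Mapping.keys c \<subseteq> cells n"
  shows "Poly_Mapping.keys (component i c) \<subseteq> (\<Pi>\<^sub>E h\<in>{1..m}. S h (i h))"
  unfolding component_def
proof (rule keys_frag_extend_subset[OF assms])
  fix s
  assume "s \<in> cells n"
  then have "s \<in> (\<Pi>\<^sub>E h\<in>{1..m}. S h (mdeg s h))"
    by (simp add: mem_cells)
  then show "Poly_Mapping.keys (if mdeg s = i then frag_of s else 0) \<subseteq> (\<Pi>\<^sub>E h\<in>{1..m}. S h (i h))"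
    by (cases "mdeg s = i") (simp_all del: PiE_iff)
qed

lemma lookup_component:
  "Poly_Mapping.lookup (component i c) s = (if mdeg s = i then Poly_Mapping.lookup c s else 0)"
  unfolding component_def
  using subset_UNIV[of "Poly_Mapping.keys c"]
  by (induction c rule: frag_induction) (auto simp: frag_extend_diff lookup_minus)

lemma component_diff: "component i (a - b) = component i a - component i b"
  by (simp add: component_def frag_extend_diff)

lemma component_add: "component i (a + b) = component i a + component i b"
  by (simp add: component_def frag_extend_add)

lemma component_0: "component i 0 = 0"
  by (simp add: component_def)

lemma component_sum: "finite I \<Longrightarrow> component i (sum f I) = (\<Sum>k\<in>I. component i (f k))"
  by (simp add: component_def frag_extend_sum o_def)

lemma cell_boundary_closed:
  assumes "s \<in> cells n"
  shows "Poly_Mapping.keys (cell_boundary s) \<subseteq> cells (n - 1)"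
  unfolding cell_boundary_def
proof (intro keys_sum_subset keys_frag_cmul_subset)
  fix h
  assume h: "h \<in> {1..m}"
  have s: "mdeg s \<in> multidegrees m n" "s \<in> (\<Pi>\<^sub>E h\<in>{1..m}. S h (mdeg s h))"
    using assms by (simp_all add: mem_cells)
  have "(mdeg s)(h := mdeg s h - 1) \<in> multidegrees m (n - 1)"
    using s(1) h by (auto simp: multidegrees_def PiE_iff extensional_def sum.remove[of _ h])
  moreover have "s(h := u) \<in> (\<Pi>\<^sub>E g\<in>{1..m}. S g (((mdeg s)(h := mdeg s h - 1)) g))"
    if "u \<in> S h (mdeg s h - 1)" for u
    using s(2) h that by (auto simp: PiE_iff extensional_def)
  moreover have "Poly_Mapping.keys (\<delta> h (s h)) \<subseteq> S h (mdeg s h - 1)"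
    using s(2) h by (intro boundary_closed) auto
  ultimately show "Poly_Mapping.keys (frag_extend (\<lambda>u. frag_of (s(h := u))) (\<delta> h (s h))) \<subseteq> cells (n - 1)"
    unfolding cells_def
    by (intro keys_frag_extend_subset[where S = "S h (mdeg s h - 1)"])
       (simp_all only: keys_frag_of insert_subset empty_subsetI UN_iff, blast)
qed

section \<open>The cells form a basis of the total complex\<close>

abbreviation "Tot \<equiv> total_complex m based_complex"

lemma grp_Tot: "grp Tot n = sum_group (multidegrees m n) tensor"
  by (simp add: total_complex_def based_complex_def)

lemma carrier_Tot: "carrier (grp Tot n) =
    {t \<in> \<Pi>\<^sub>E i\<in>multidegrees m n. carrier (tensor i). finite {i \<in> multidegrees m n. t i \<noteq> \<one>\<^bsub>tensor i\<^esub>}}"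
  unfolding grp_Tot
  by (rule carrier_sum_group) (rule comm_group.axioms(2)[OF F.comm_group_tensor_product])

lemma comm_group_Tot: "comm_group (grp Tot n)"
proof (rule group.group_comm_groupI)
  have grp: "group (tensor i)" for i
    by (rule comm_group.axioms(2)[OF F.comm_group_tensor_product])
  then show "group (grp Tot n)"
    by (simp add: grp_Tot)
  fix x y
  assume "x \<in> carrier (grp Tot n)" "y \<in> carrier (grp Tot n)"
  then have "x i \<otimes>\<^bsub>tensor i\<^esub> y i = y i \<otimes>\<^bsub>tensor i\<^esub> x i" if "i \<in> multidegrees m n" for i
    using that
    by (intro comm_monoid.m_comm[OF comm_group.axioms(1)[OF F.comm_group_tensor_product]])
       (auto simp: carrier_Tot)
  then show "x \<otimes>\<^bsub>grp Tot n\<^esub> y = y \<otimes>\<^bsub>grp Tot n\<^esub> x"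
    by (auto simp: grp_Tot intro: restrict_ext)
qed

text \<open>For \<open>m\<close> at least 2 there are infinitely many multidegrees of a given sum,
  so finite support has to be proved: only the multidegrees of the finitely many cells in
  \<open>c\<close> can contribute.\<close>

lemma cells_to_total_closed:
  assumes "Poly_Mapping.keys c \<subseteq> cells n"
  shows "cells_to_total n c \<in> carrier (grp Tot n)"
proof -
  have "cells_to_total n c \<in> (\<Pi>\<^sub>E i\<in>multidegrees m n. carrier (tensor i))"
    unfolding cells_to_total_def
    using component_closed[OF assms]
    by (intro restrict_PiE_iff[THEN iffD2] ballI F.tensor_class_closed F.pure_closed)
  moreover have "{i \<in> multidegrees m n. cells_to_total n c i \<noteq> \<one>\<^bsub>tensor i\<^esub>} \<subseteq> mdeg ` Poly_Mapping.keys c"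
  proof
    fix i
    assume "i \<in> {i \<in> multidegrees m n. cells_to_total n c i \<noteq> \<one>\<^bsub>tensor i\<^esub>}"
    then have i: "i \<in> multidegrees m n" and "cells_to_total n c i \<noteq> \<one>\<^bsub>tensor i\<^esub>"
      by simp_all
    then have ne: "tclass i (pure {1..m} (component i c)) \<noteq> tclass i 0"
      unfolding cells_to_total_def F.one_tensor_product by (simp only: restrict_apply' if_True simp_thms)
    show "i \<in> mdeg ` Poly_Mapping.keys c"
    proof (rule ccontr)
      assume "i \<notin> mdeg ` Poly_Mapping.keys c"
      then have "component i c = 0"
        unfolding component_def by (intro frag_extend_eq_0) auto
      with ne show False
        by simp
    qed
  qed
  ultimately show ?thesis
    unfolding carrier_Tot using finite_subset[of _ "mdeg ` Poly_Mapping.keys c"] by simp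
qed

lemma cells_to_total_hom: "cells_to_total n \<in> hom (free_Abelian_group (cells n)) (grp Tot n)"
proof (rule homI)
  fix c c'
  assume c: "c \<in> carrier (free_Abelian_group (cells n))" "c' \<in> carrier (free_Abelian_group (cells n))"
  have "tclass i (pure {1..m} (component i (c + c'))) =
      tclass i (pure {1..m} (component i c)) \<otimes>\<^bsub>tensor i\<^esub> tclass i (pure {1..m} (component i c'))" for i
    unfolding component_add frag_extend_add
    using component_closed[of _ n i] c by (intro F.tensor_class_add F.pure_closed) simp_all
  then show "cells_to_total n (c \<otimes>\<^bsub>free_Abelian_group (cells n)\<^esub> c') =
      cells_to_total n c \<otimes>\<^bsub>grp Tot n\<^esub> cells_to_total n c'"
    by (auto simp: cells_to_total_def grp_Tot intro!: restrict_ext)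
qed (simp add: cells_to_total_closed)

text \<open>\<open>expand\<close> recovers each component from its class, and the coefficient of a
  cell is visible in the component at the multidegree of that cell.\<close>

lemma cells_to_total_inj: "inj_on (cells_to_total n) (carrier (free_Abelian_group (cells n)))"
proof (rule inj_onI)
  fix c c'
  assume c: "c \<in> carrier (free_Abelian_group (cells n))" "c' \<in> carrier (free_Abelian_group (cells n))"
    and eq: "cells_to_total n c = cells_to_total n c'"
  have comp: "component i c = component i c'" if i: "i \<in> multidegrees m n" for i
  proof -
    note cl = component_closed[of c n i] component_closed[of c' n i]
    have "tclass i (pure {1..m} (component i c)) = tclass i (pure {1..m} (component i c'))"
      using fun_cong[OF eq, of i] i by (simp add: cells_to_total_def)
    then have "expand {1..m} (pure {1..m} (component i c)) = expand {1..m} (pure {1..m} (component i c'))"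
      using F.tensor_class_eq_iff_expand[OF F.pure_closed F.pure_closed] cl c by simp
    then show ?thesis
      using F.expand_pure[OF cl(1)] F.expand_pure[OF cl(2)] c by simp
  qed
  show "c = c'"
  proof (rule poly_mapping_eqI)
    fix s
    show "Poly_Mapping.lookup c s = Poly_Mapping.lookup c' s"
    proof (cases "s \<in> cells n")
      case True
      then have "component (mdeg s) c = component (mdeg s) c'"
        using comp by (simp add: mem_cells)
      then show ?thesis
        using lookup_component[of "mdeg s" _ s] by metis
    next
      case False
      then have "s \<notin> Poly_Mapping.keys c" "s \<notin> Poly_Mapping.keys c'"
        using c by auto
      then show ?thesis
        by (simp add: in_keys_iff)
    qed
  qed
qed

text \<open>Representatives of the finitely many nontrivial entries of \<open>t\<close> are expanded
  and added up. Different entries give cells of different multidegrees, so \<open>component\<close>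
  separates the sum again.\<close>

lemma cells_to_total_surj:
  assumes "t \<in> carrier (grp Tot n)"
  shows "t \<in> cells_to_total n ` carrier (free_Abelian_group (cells n))"
proof -
  define Z where "Z = {i \<in> multidegrees m n. t i \<noteq> \<one>\<^bsub>tensor i\<^esub>}"
  have fin: "finite Z" and t: "t \<in> (\<Pi>\<^sub>E i\<in>multidegrees m n. carrier (tensor i))"
    using assms by (simp_all add: carrier_Tot Z_def)
  have "\<exists>c. Poly_Mapping.keys c \<subseteq> (\<Pi>\<^sub>E h\<in>{1..m}. carrier (free_Abelian_group (S h (i h)))) \<and> t i = tclass i c"
    if i: "i \<in> multidegrees m n" for i
  proof -
    have "t i \<in> carrier (tensor i)"
      using t i by (rule PiE_mem)
    then obtain c where "t i = tclass i c" "c \<in> carrier (F.tuple_group i)"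
      unfolding F.carrier_tensor_product by (rule imageE)
    then show ?thesis
      by (intro exI[of _ c]) (simp only: carrier_free_Abelian_group_iff)
  qed
  then have "\<forall>i\<in>multidegrees m n. \<exists>c. Poly_Mapping.keys c \<subseteq>
      (\<Pi>\<^sub>E h\<in>{1..m}. carrier (free_Abelian_group (S h (i h)))) \<and> t i = tclass i c"
    by (intro ballI)
  from bchoice[OF this] obtain c where "\<forall>i\<in>multidegrees m n. Poly_Mapping.keys (c i) \<subseteq>
      (\<Pi>\<^sub>E h\<in>{1..m}. carrier (free_Abelian_group (S h (i h)))) \<and> t i = tclass i (c i)" ..
  then have c: "Poly_Mapping.keys (c i) \<subseteq> (\<Pi>\<^sub>E h\<in>{1..m}. carrier (free_Abelian_group (S h (i h))))"
      "t i = tclass i (c i)" if "i \<in> multidegrees m n" for i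
    using that by (simp_all only:)
  define e where "e = (\<Sum>i\<in>Z. expand {1..m} (c i))"
  have Z: "i \<in> multidegrees m n" if "i \<in> Z" for i
    using that by (simp add: Z_def)
  have closed: "Poly_Mapping.keys (expand {1..m} (c i)) \<subseteq> (\<Pi>\<^sub>E h\<in>{1..m}. S h (i h))" if "i \<in> Z" for i
    by (rule F.expand_closed[OF c(1)[OF Z[OF that]]])
  have e: "Poly_Mapping.keys e \<subseteq> cells n"
    unfolding e_def
  proof (rule keys_sum_subset)
    fix i
    assume "i \<in> Z"
    then show "Poly_Mapping.keys (expand {1..m} (c i)) \<subseteq> cells n"
      using closed[of i] Z[of i] unfolding cells_def by blast
  qed
  have comp: "component i e = (if i \<in> Z then expand {1..m} (c i) else 0)" for i
  proof -
    have "component i e = (\<Sum>j\<in>Z. if j = i then expand {1..m} (c j) else 0)"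
      unfolding e_def component_sum[OF fin]
      using closed Z by (intro sum.cong component_of_homogeneous) auto
    then show ?thesis
      using fin by (simp only: sum.delta)
  qed
  have "cells_to_total n e = t"
  proof (rule extensionalityI[of _ "multidegrees m n"])
    fix i
    assume i: "i \<in> multidegrees m n"
    show "cells_to_total n e i = t i"
    proof (cases "i \<in> Z")
      case True
      have cl: "Poly_Mapping.keys (pure {1..m} (expand {1..m} (c i)))
          \<subseteq> (\<Pi>\<^sub>E h\<in>{1..m}. carrier (free_Abelian_group (S h (i h))))"
        using closed[OF True] by (rule F.pure_closed)
      have "tclass i (pure {1..m} (expand {1..m} (c i))) = tclass i (c i)"
        using F.tensor_class_eq_iff_expand[OF cl c(1)[OF i]] F.expand_pure[OF closed[OF True]] by (simp only:)
      then show ?thesis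
        using i c(2)[OF i] comp[of i] True by (simp add: cells_to_total_def)
    next
      case False
      then have "t i = tclass i 0"
        using i by (simp add: Z_def F.one_tensor_product)
      then show ?thesis
        using False i comp[of i] by (simp add: cells_to_total_def)
    qed
  next
    show "cells_to_total n e \<in> extensional (multidegrees m n)"
      unfolding cells_to_total_def by (rule restrict_extensional)
    show "t \<in> extensional (multidegrees m n)"
      using t by (simp add: PiE_iff)
  qed
  then show ?thesis
    using e by (intro image_eqI[of _ _ e]) simp_all
qed

lemma cells_to_total_iso: "cells_to_total n \<in> iso (free_Abelian_group (cells n)) (grp Tot n)"
  using cells_to_total_hom[of n] cells_to_total_inj[of n] cells_to_total_surj[of _ n]
  by (auto simp: iso_def bij_betw_def hom_in_carrier)

section \<open>The boundary of the total complex in the basis of cells\<close>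

lemma mdeg_upd: "h \<in> {1..m} \<Longrightarrow> mdeg (s(h := u)) = (mdeg s)(h := deg u)"
  by (auto simp: mdeg_def)

lemma tclass_sign_pow:
  assumes "Poly_Mapping.keys c \<subseteq> (\<Pi>\<^sub>E h\<in>{1..m}. carrier (free_Abelian_group (S h (j h))))"
  shows "tclass j c [^]\<^bsub>tensor j\<^esub> koszul_sign i h = tclass j (frag_cmul (koszul_sign i h) c)"
proof -
  interpret T: comm_group "tensor j"
    by (rule F.comm_group_tensor_product)
  have "tclass j c \<in> carrier (tensor j)"
    by (rule F.tensor_class_closed[OF assms])
  then show ?thesis
    using F.tensor_class_minus[OF assms] by (auto simp: koszul_sign_def T.int_pow_neg)
qed

abbreviation slot_map where
  "slot_map h \<equiv> frag_extend (\<lambda>x. frag_of (\<lambda>g\<in>{1..m}. (if g = h then frag_extend (\<delta> h) else id) (x g)))"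

text \<open>Linearity reduces this to one cell \<open>s\<close>. Its \<open>h\<close>-th term on the
  left can be nonzero only if \<open>mdeg s\<close> is \<open>j\<close> raised by one in slot
  \<open>h\<close>, and exactly then the \<open>h\<close>-th part of \<open>cell_boundary s\<close>
  sits in multidegree \<open>j\<close>; so the sums agree term by term.\<close>

lemma expand_slot_map_component:
  assumes "Poly_Mapping.keys c \<subseteq> cells n" and j: "j \<in> multidegrees m (n - 1)"
  shows "(\<Sum>h = 1..m. frag_cmul (koszul_sign j h)
      (expand {1..m} (slot_map h (pure {1..m} (component (j(h := j h + 1)) c))))) =
    component j (frag_extend cell_boundary c)"
  using assms(1)
proof (induction c rule: frag_induction)
  case zero
  then show ?case
    by (simp add: component_0)
next
  case (one s)
  then have s: "mdeg s \<in> multidegrees m n" "s \<in> (\<Pi>\<^sub>E h\<in>{1..m}. S h (mdeg s h))"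
    by (simp_all add: mem_cells)
  have "frag_cmul (koszul_sign j h)
      (expand {1..m} (slot_map h (pure {1..m} (component (j(h := j h + 1)) (frag_of s))))) =
    component j (frag_cmul (koszul_sign (mdeg s) h) (frag_extend (\<lambda>u. frag_of (s(h := u))) (\<delta> h (s h))))"
    (is "?L = ?R") if h: "h \<in> {1..m}" for h
  proof -
    have keys: "Poly_Mapping.keys (\<delta> h (s h)) \<subseteq> S h (mdeg s h - 1)"
      using s(2) h by (intro boundary_closed) auto
    have iff: "mdeg (s(h := u)) = j \<longleftrightarrow> mdeg s = j(h := j h + 1)" if "u \<in> Poly_Mapping.keys (\<delta> h (s h))" for u
    proof -
      have "deg u = mdeg s h - 1"
        using keys that deg by blast
      then show ?thesis
        unfolding mdeg_upd[OF h] by (auto simp: fun_eq_iff)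
    qed
    have R: "?R = frag_cmul (koszul_sign (mdeg s) h)
        (frag_extend (\<lambda>u. if mdeg (s(h := u)) = j then frag_of (s(h := u)) else 0) (\<delta> h (s h)))"
      unfolding component_def frag_extend_cmul frag_extend_frag_extend frag_extend_of ..
    show ?thesis
    proof (cases "mdeg s = j(h := j h + 1)")
      case True
      \<comment> \<open>The sign of slot \<open>h\<close> looks only at earlier slots, where source
        and target have the same degrees. Hence it does not matter that one side takes it from the
        source and the other from the target.\<close>
      have "(\<Sum>g = 1..<h. mdeg s g) = (\<Sum>g = 1..<h. j g)"
        unfolding True by (rule sum.cong) auto
      then have sign: "koszul_sign (mdeg s) h = koszul_sign j h"
        by (simp add: koszul_sign_def)
      have "(\<lambda>g\<in>{1..m}. (if g = h then frag_extend (\<delta> h) else id) ((\<lambda>i\<in>{1..m}. frag_of (s i)) g)) =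
          (\<lambda>g\<in>{1..m}. if g = h then \<delta> h (s h) else frag_of (s g))"
        by (rule restrict_ext) simp
      then have "expand {1..m} (slot_map h (pure {1..m} (component (j(h := j h + 1)) (frag_of s)))) =
          multilinear_expansion {1..m} (\<lambda>g\<in>{1..m}. if g = h then \<delta> h (s h) else frag_of (s g))"
        unfolding component_def by (simp only: True frag_extend_of if_True refl)
      also have "\<dots> = frag_extend (\<lambda>u. frag_of (s(h := u))) (\<delta> h (s h))"
        using s(2) by (intro F.multilinear_expansion_upd_frag_extend[OF h]) (simp only: PiE_iff)
      finally have "?L = frag_cmul (koszul_sign j h) (frag_extend (\<lambda>u. frag_of (s(h := u))) (\<delta> h (s h)))"
        by simp
      moreover have "frag_extend (\<lambda>u. if mdeg (s(h := u)) = j then frag_of (s(h := u)) else 0) (\<delta> h (s h)) =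
          frag_extend (\<lambda>u. frag_of (s(h := u))) (\<delta> h (s h))"
        by (rule frag_extend_eq) (simp only: iff True if_True refl)
      ultimately show ?thesis
        unfolding R by (simp only: sign)
    next
      case False
      have "frag_extend (\<lambda>u. if mdeg (s(h := u)) = j then frag_of (s(h := u)) else 0) (\<delta> h (s h)) = 0"
        by (rule frag_extend_eq_0) (simp only: iff False if_False)
      then show ?thesis
        using False unfolding R by (simp add: component_def)
    qed
  qed
  then show ?case
    unfolding cell_boundary_def frag_extend_of
    by (subst component_sum) (simp_all only: finite_atLeastAtMost cong: sum.cong)
next
  case (diff a b)
  have sub: "frag_cmul k (x - y) = frag_cmul k x - frag_cmul k y" for k and x y :: "(nat \<Rightarrow> 'b) \<Rightarrow>\<^sub>0 int"
    by (rule poly_mapping_eqI) (simp add: lookup_minus algebra_simps)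
  show ?case
    unfolding component_diff frag_extend_diff sub sum_subtractf diff ..
qed

lemma bdry_Tot:
  "bdry Tot n t = (\<lambda>j\<in>multidegrees m (n - 1). \<Otimes>\<^bsub>tensor j\<^esub>h\<in>{1..m}.
    tensor_map {1..m} (\<lambda>g. free_Abelian_group (S g (j g)))
      (\<lambda>g. if g = h then frag_extend (\<delta> h) else id) (t (j(h := j h + 1)))
    [^]\<^bsub>tensor j\<^esub> koszul_sign j h)"
  by (simp only: total_complex_def based_complex_def Let_def koszul_sign_def graded_complex.simps)

text \<open>Induced maps, signs and products are all moved to representatives. The two
  representatives obtained are in general different combinations of tuples, but they have the same
  expansion, and that decides equality of classes.\<close>

lemma cells_to_total_boundary:
  assumes c: "Poly_Mapping.keys c \<subseteq> cells n"
  shows "bdry Tot n (cells_to_total n c) = cells_to_total (n - 1) (frag_extend cell_boundary c)"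
proof -
  have "(\<Otimes>\<^bsub>tensor j\<^esub>h\<in>{1..m}.
      tensor_map {1..m} (\<lambda>g. free_Abelian_group (S g (j g)))
        (\<lambda>g. if g = h then frag_extend (\<delta> h) else id) (cells_to_total n c (j(h := j h + 1)))
      [^]\<^bsub>tensor j\<^esub> koszul_sign j h) = tclass j (pure {1..m} (component j (frag_extend cell_boundary c)))"
    if j: "j \<in> multidegrees m (n - 1)" for j
  proof -
    define u where "u h = slot_map h (pure {1..m} (component (j(h := j h + 1)) c))" for h
    have hom: "abelian_family_hom {1..m} (\<lambda>g. free_Abelian_group (S g ((j(h := j h + 1)) g)))
        (\<lambda>g. free_Abelian_group (S g (j g))) (\<lambda>g. if g = h then frag_extend (\<delta> h) else id)" for h
    proof unfold_locales
      fix g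
      have "frag_extend (\<delta> h) \<in> hom (free_Abelian_group (S h (j h + 1))) (free_Abelian_group (S h (j h)))"
        using boundary_closed[of _ h "j h + 1"] by (intro frag_extend_hom) simp
      then show "(if g = h then frag_extend (\<delta> h) else id)
          \<in> hom (free_Abelian_group (S g ((j(h := j h + 1)) g))) (free_Abelian_group (S g (j g)))"
        by (auto simp: hom_def)
    qed
    have cl: "Poly_Mapping.keys (u h) \<subseteq> (\<Pi>\<^sub>E g\<in>{1..m}. carrier (free_Abelian_group (S g (j g))))" for h
      unfolding u_def
      by (rule abelian_family_hom.tuple_map_closed[OF hom F.pure_closed[OF component_closed[OF c]]])
    have "tensor_map {1..m} (\<lambda>g. free_Abelian_group (S g (j g)))
        (\<lambda>g. if g = h then frag_extend (\<delta> h) else id) (cells_to_total n c (j(h := j h + 1)))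
        [^]\<^bsub>tensor j\<^esub> koszul_sign j h = tclass j (frag_cmul (koszul_sign j h) (u h))"
      if h: "h \<in> {1..m}" for h
    proof -
      have "j(h := j h + 1) \<in> multidegrees m n"
        using j h by (auto simp: multidegrees_def PiE_iff extensional_def sum.remove[of _ h])
      then have "cells_to_total n c (j(h := j h + 1)) =
          tclass (j(h := j h + 1)) (pure {1..m} (component (j(h := j h + 1)) c))"
        by (simp add: cells_to_total_def)
      then show ?thesis
        using abelian_family_hom.tensor_map_tensor_class[OF hom[of h]] tclass_sign_pow[OF cl]
        by (simp only: u_def)
    qed
    moreover have cl': "Poly_Mapping.keys (frag_cmul (koszul_sign j h) (u h))
        \<subseteq> (\<Pi>\<^sub>E g\<in>{1..m}. carrier (free_Abelian_group (S g (j g))))" for h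
      by (rule keys_frag_cmul_subset[OF cl])
    ultimately have "(\<Otimes>\<^bsub>tensor j\<^esub>h\<in>{1..m}.
        tensor_map {1..m} (\<lambda>g. free_Abelian_group (S g (j g)))
          (\<lambda>g. if g = h then frag_extend (\<delta> h) else id) (cells_to_total n c (j(h := j h + 1)))
        [^]\<^bsub>tensor j\<^esub> koszul_sign j h) = (\<Otimes>\<^bsub>tensor j\<^esub>h\<in>{1..m}. tclass j (frag_cmul (koszul_sign j h) (u h)))"
      using F.tensor_class_closed[OF cl']
      by (intro comm_monoid.finprod_cong[OF comm_group.axioms(1)[OF F.comm_group_tensor_product]])
         (simp_all add: simp_implies_def)
    also have "\<dots> = tclass j (\<Sum>h = 1..m. frag_cmul (koszul_sign j h) (u h))"
      by (rule F.finprod_tensor_class) (simp_all only: finite_atLeastAtMost cl')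
    also have "\<dots> = tclass j (pure {1..m} (component j (frag_extend cell_boundary c)))"
    proof (rule F.tensor_class_eq_iff_expand[THEN iffD2])
      show "Poly_Mapping.keys (\<Sum>h = 1..m. frag_cmul (koszul_sign j h) (u h))
          \<subseteq> (\<Pi>\<^sub>E g\<in>{1..m}. carrier (free_Abelian_group (S g (j g))))"
        by (rule keys_sum_subset) (rule cl')
      have "Poly_Mapping.keys (frag_extend cell_boundary c) \<subseteq> cells (n - 1)"
        by (rule keys_frag_extend_subset[OF c cell_boundary_closed])
      from component_closed[OF this]
      have comp: "Poly_Mapping.keys (component j (frag_extend cell_boundary c)) \<subseteq> (\<Pi>\<^sub>E h\<in>{1..m}. S h (j h))" .
      from F.pure_closed[OF this]
      show "Poly_Mapping.keys (pure {1..m} (component j (frag_extend cell_boundary c)))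
          \<subseteq> (\<Pi>\<^sub>E g\<in>{1..m}. carrier (free_Abelian_group (S g (j g))))" .
      have "expand {1..m} (\<Sum>h = 1..m. frag_cmul (koszul_sign j h) (u h)) =
          (\<Sum>h = 1..m. frag_cmul (koszul_sign j h) (expand {1..m} (u h)))"
        by (simp only: frag_extend_sum finite_atLeastAtMost o_def frag_extend_cmul)
      also have "\<dots> = component j (frag_extend cell_boundary c)"
        unfolding u_def by (rule expand_slot_map_component[OF c j])
      finally show "expand {1..m} (\<Sum>h = 1..m. frag_cmul (koszul_sign j h) (u h)) =
          expand {1..m} (pure {1..m} (component j (frag_extend cell_boundary c)))"
        by (simp only: F.expand_pure[OF comp])
    qed
    finally show ?thesis .
  qed
  then show ?thesis
    unfolding bdry_Tot cells_to_total_def[of "n - 1"] by (rule restrict_ext)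
qed

end

section \<open>Geodesic chains\<close>

lemma proper_chains_iff:
  "x \<in> proper_chains X n \<longleftrightarrow> x \<noteq> [] \<and> int (length x) = n + 1 \<and> set x \<subseteq> X \<and> distinct_adj x"
proof -
  have "(\<forall>i\<in>{1..<length x}. x ! (i - 1) \<noteq> x ! i) \<longleftrightarrow> (\<forall>i. Suc i < length x \<longrightarrow> x ! i \<noteq> x ! Suc i)"
    (is "?L \<longleftrightarrow> ?R")
  proof
    show ?R if ?L
      using that[rule_format, of "Suc i" for i] by simp
    show ?L if R: ?R
    proof
      fix i
      assume "i \<in> {1..<length x}"
      then show "x ! (i - 1) \<noteq> x ! i"
        using R[rule_format, of "i - 1"] by simp
    qed
  qed
  then show ?thesis
    by (simp add: proper_chains_def distinct_adj_conv_nth)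
qed

lemma chain_length_conv: "chain_length d x = (\<Sum>i<length x - 1. d (x ! i) (x ! Suc i))"
proof (cases x)
  case (Cons a y)
  have "chain_length d x = (\<Sum>i = Suc 0..<Suc (length y). d (x ! (i - 1)) (x ! i))"
    by (simp add: chain_length_def Cons One_nat_def)
  then show ?thesis
    unfolding sum.atLeast_Suc_lessThan_Suc_shift by (simp add: Cons o_def atLeast0LessThan)
qed (simp add: chain_length_def)

lemma chain_length_Cons: "chain_length d (a # b # x) = d a b + chain_length d (b # x)"
  by (simp add: chain_length_conv sum.lessThan_Suc_shift del: sum.lessThan_Suc)

lemma chain_length_append:
  "chain_length d (x @ a # y) = chain_length d (x @ [a]) + chain_length d (a # y)"
proof (induction x)
  case Nil
  then show ?case
    by (simp add: chain_length_def)
next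
  case (Cons b x)
  then show ?case
    by (cases x) (simp_all add: chain_length_Cons)
qed

context Metric_space
begin

lemma dist_le_sum_steps:
  assumes "set x \<subseteq> M" "i \<le> j" "j < length x"
  shows "d (x ! i) (x ! j) \<le> (\<Sum>k = Suc i..<Suc j. d (x ! (k - 1)) (x ! k))"
  using assms(2,3)
proof (induction j rule: dec_induct)
  case base
  then show ?case
    using assms(1) by (simp add: subset_iff)
next
  case (step j)
  then have "x ! i \<in> M" "x ! j \<in> M" "x ! Suc j \<in> M"
    using assms(1) by (auto simp: subset_iff)
  then have "d (x ! i) (x ! Suc j) \<le> d (x ! i) (x ! j) + d (x ! j) (x ! Suc j)"
    by (rule triangle)
  with step show ?case
    by (simp add: One_nat_def)
qed

definition geodesic :: "'a list \<Rightarrow> bool" where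
  "geodesic x \<longleftrightarrow> set x \<subseteq> M \<and> chain_length d x = d (x ! 0) (x ! (length x - 1))"

text \<open>The lengths of the pieces before \<open>i\<close>, between \<open>i\<close> and
  \<open>j\<close>, and after \<open>j\<close> bound the three distances from above, and they add up
  to the distance of the end points. By the triangle inequality no piece can be longer than its
  distance.\<close>

lemma geodesic_dist:
  assumes "geodesic x" "i \<le> j" "j < length x"
  shows "d (x ! i) (x ! j) = (\<Sum>k = Suc i..<Suc j. d (x ! (k - 1)) (x ! k))"
proof -
  let ?s = "\<lambda>i j. \<Sum>k = Suc i..<Suc j. d (x ! (k - 1)) (x ! k)"
  define n where "n = length x - 1"
  have n: "j \<le> n" "n < length x" "Suc n = length x"
    using assms by (auto simp: n_def)
  have x: "set x \<subseteq> M" "?s 0 n = d (x ! 0) (x ! n)"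
    using assms(1) n by (simp_all add: geodesic_def chain_length_def n_def One_nat_def)
  have split: "?s 0 n = ?s 0 i + ?s i j + ?s j n"
    using assms n by (simp only: sum.atLeastLessThan_concat Suc_le_mono zero_le)
  have "x ! k \<in> M" if "k < length x" for k
    using x(1) nth_mem[OF that] by blast
  moreover have "0 < length x" "i < length x"
    using assms n by linarith+
  ultimately have "x ! 0 \<in> M" "x ! i \<in> M" "x ! j \<in> M" "x ! n \<in> M"
    using assms n(2) by blast+
  then have "d (x ! 0) (x ! n) \<le> d (x ! 0) (x ! i) + d (x ! i) (x ! j) + d (x ! j) (x ! n)"
    using triangle[of "x ! 0" "x ! i" "x ! n"] triangle[of "x ! i" "x ! j" "x ! n"] by linarith
  then show ?thesis
    using dist_le_sum_steps[OF x(1), of 0 i] dist_le_sum_steps[OF x(1), of i j]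
      dist_le_sum_steps[OF x(1), of j n] assms n x(2) split by simp
qed

lemma geodesic_between:
  assumes "geodesic x" "i \<le> j" "j \<le> k" "k < length x"
  shows "between d (x ! i) (x ! j) (x ! k)"
proof -
  have "(\<Sum>l = Suc i..<Suc j. d (x ! (l - 1)) (x ! l)) + (\<Sum>l = Suc j..<Suc k. d (x ! (l - 1)) (x ! l)) =
      (\<Sum>l = Suc i..<Suc k. d (x ! (l - 1)) (x ! l))"
    using assms by (simp only: sum.atLeastLessThan_concat Suc_le_mono)
  then show ?thesis
    using geodesic_dist[OF assms(1), of i j] geodesic_dist[OF assms(1), of j k]
      geodesic_dist[OF assms(1), of i k] assms(2-4) unfolding between_def by linarith
qed

text \<open>A geodesic without repeated neighbours never returns to a point: the distance between
  two positions is a sum of positive steps.\<close>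

lemma geodesic_neq:
  assumes "geodesic x" "distinct_adj x" "i < j" "j < length x"
  shows "x ! i \<noteq> x ! j"
proof -
  have x: "set x \<subseteq> M"
    using assms(1) by (simp add: geodesic_def)
  have "0 < (\<Sum>k = Suc i..<Suc j. d (x ! (k - 1)) (x ! k))"
  proof (rule sum_pos)
    fix k
    assume k: "k \<in> {Suc i..<Suc j}"
    then have "x ! (k - 1) \<noteq> x ! Suc (k - 1)"
      using assms by (intro distinct_adj_nth) simp_all
    moreover have "x ! (k - 1) \<in> M" "x ! k \<in> M"
      using k x assms by (auto simp: subset_iff)
    ultimately show "0 < d (x ! (k - 1)) (x ! k)"
      using k mdist_pos_eq by auto
  qed (use assms in auto)
  moreover have "x ! j \<in> M"
    using x assms by (auto simp: subset_iff)
  ultimately show ?thesis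
    using geodesic_dist[of x i j] assms by auto
qed

text \<open>Telescoping: each step increases the distance from the first point by its own
  length.\<close>

lemma chain_length_eq_dist:
  assumes "x ! 0 \<in> M" and "\<And>k. Suc k < length x \<Longrightarrow> between d (x ! 0) (x ! k) (x ! Suc k)"
    and "x \<noteq> []"
  shows "chain_length d x = d (x ! 0) (x ! (length x - 1))"
proof -
  have "(\<Sum>k = Suc 0..<Suc j. d (x ! (k - 1)) (x ! k)) = d (x ! 0) (x ! j)" if "j < length x" for j
    using that
  proof (induction j)
    case 0
    then show ?case
      using assms(1) by simp
  next
    case (Suc j)
    then show ?case
      using assms(2)[of j] by (simp add: between_def One_nat_def)
  qed
  from this[of "length x - 1"] assms(3) show ?thesis
    by (simp add: chain_length_def One_nat_def)
qed

text \<open>The order on I(a,b) is about distances from \<open>a\<close>, so an increasing chain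
  that ends in \<open>b\<close> meets exactly the telescoping condition for a geodesic. Conversely,
  \<open>a\<close> and two later points of a geodesic satisfy the equality that defines the order.
  The degree is chosen to fit the length of \<open>u\<close>, so it imposes no condition.\<close>

lemma interval_simplex_iff_geodesic:
  assumes ab: "a \<in> M" "b \<in> M" "a \<noteq> b"
  shows "u \<in> order_simplices (interval M d a b) (interval_le d a) (int (length u) - 1) \<longleftrightarrow>
    distinct_adj (a # u @ [b]) \<and> geodesic (a # u @ [b])"
    (is "?L \<longleftrightarrow> ?R")
proof
  let ?x = "a # u @ [b]"
  assume ?L
  then have u: "set u \<subseteq> M" and "\<forall>p\<in>set u. strictly_between d a p b"
    and sorted: "sorted_wrt (\<lambda>u v. interval_le d a u v \<and> u \<noteq> v) u"
    by (auto simp: order_simplices_def interval_def)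
  then have int: "strictly_between d a (u ! k) b" if "k < length u" for k
    using that by simp
  have le: "between d a (u ! i) (u ! j) \<and> u ! i \<noteq> u ! j" if "i < j" "j < length u" for i j
    using sorted that by (auto simp: sorted_wrt_iff_nth_less interval_le_def)
  \<comment> \<open>The leading \<open>a\<close> shifts indices by one, and index
    \<open>length u\<close> yields \<open>b\<close>; thus the last step below is covered by the same
    argument as the others.\<close>
  have nth: "?x ! Suc k = (if k < length u then u ! k else b)" if "k \<le> length u" for k
    using that by (auto simp: nth_append)
  have step: "between d a (?x ! k) (?x ! Suc k) \<and> ?x ! k \<noteq> ?x ! Suc k" if "Suc k < length ?x" for k
  proof (cases k)
    case 0
    then show ?thesis
      using int[of 0] ab nth[of 0] by (auto simp: between_def strictly_between_def)
  next
    case (Suc i)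
    then have "Suc i \<le> length u"
      using that by simp
    then show ?thesis
      using le[of i "Suc i"] int[of i] Suc nth[of i] nth[of "Suc i"] by (auto simp: strictly_between_def)
  qed
  then have "distinct_adj ?x"
    unfolding distinct_adj_conv_nth by blast
  moreover have "chain_length d ?x = d (?x ! 0) (?x ! (length ?x - 1))"
  proof (rule chain_length_eq_dist)
    show "between d (?x ! 0) (?x ! k) (?x ! Suc k)" if "Suc k < length ?x" for k
      using step[OF that] by simp
  qed (use ab in simp_all)
  ultimately show ?R
    using ab u by (simp add: geodesic_def)
next
  let ?x = "a # u @ [b]"
  assume ?R
  then have x: "distinct_adj ?x" "geodesic ?x"
    by simp_all
  have nth: "u ! k = ?x ! Suc k" if "k < length u" for k
    using that by (simp add: nth_append)
  have a: "?x ! 0 = a" and b: "?x ! Suc (length u) = b"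
    by simp_all
  have "strictly_between d a (u ! k) b" if "k < length u" for k
    using geodesic_between[OF x(2), of 0 "Suc k" "Suc (length u)"]
      geodesic_neq[OF x(2,1), of 0 "Suc k"] geodesic_neq[OF x(2,1), of "Suc k" "Suc (length u)"] that
    unfolding strictly_between_def a b nth[OF that] by simp
  then have "strictly_between d a p b" if "p \<in> set u" for p
    using that by (auto simp: in_set_conv_nth)
  moreover have "set u \<subseteq> M"
    using x(2) by (simp add: geodesic_def)
  moreover have "interval_le d a (u ! i) (u ! j) \<and> u ! i \<noteq> u ! j" if "i < j" "j < length u" for i j
    using geodesic_between[OF x(2), of 0 "Suc i" "Suc j"]
      geodesic_neq[OF x(2,1), of 0 "Suc i"] geodesic_neq[OF x(2,1), of "Suc i" "Suc j"] that
    unfolding interval_le_def a using nth[of i] nth[of j] by simp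
  ultimately show ?L
    by (auto simp: order_simplices_def interval_def sorted_wrt_iff_nth_less)
qed

end

section \<open>Gluing simplices along a frame\<close>

text \<open>Growing at the right end makes \<open>glue F s h\<close> a prefix of
  \<open>glue F s m\<close> for \<open>h \<le> m\<close>. So \<open>F ! h\<close> is at position
  \<open>length (glue F s h) - 1\<close>, and point \<open>k\<close> of \<open>s h\<close> is at
  \<open>length (glue F s (h - 1)) + k\<close>. Simplices are numbered from 1, like the tensor
  factors.\<close>

primrec glue :: "'a list \<Rightarrow> (nat \<Rightarrow> 'a list) \<Rightarrow> nat \<Rightarrow> 'a list" where
  "glue F s 0 = [F ! 0]"
| "glue F s (Suc m) = glue F s m @ s (Suc m) @ [F ! Suc m]"

lemma glue_cong: "(\<And>h. h \<in> {1..m} \<Longrightarrow> s h = t h) \<Longrightarrow> glue F s m = glue F t m"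
  by (induction m) auto

lemma glue_conv_butlast: "glue F s m = butlast (glue F s m) @ [F ! m]"
  by (cases m) (simp_all add: butlast_append)

text \<open>Moves \<open>F ! m\<close> from the end of the prefix to the head of the new segment, so
  that the segment becomes a chain between two frame points.\<close>

lemma glue_Suc: "glue F s (Suc m) = butlast (glue F s m) @ F ! m # s (Suc m) @ [F ! Suc m]"
  using arg_cong[OF glue_conv_butlast[of F s m], of "\<lambda>x. x @ s (Suc m) @ [F ! Suc m]"] by simp

lemma glue_nonempty [simp]: "glue F s m \<noteq> []"
  by (cases m) simp_all

lemma length_glue_pos: "0 < length (glue F s m)"
  by simp

lemma length_glue: "length (glue F s m) = 1 + m + (\<Sum>h = 1..m. length (s h))"
  by (induction m) simp_all

lemma sum_lessThan_add:
  fixes g :: "nat \<Rightarrow> 'b :: comm_monoid_add"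
  shows "(\<Sum>i<a + b. g i) = (\<Sum>i<a. g i) + (\<Sum>i<b. g (a + i))"
  by (induction b) (simp_all add: add.assoc)

text \<open>Sorts the terms of the boundary of a glued chain: those at frame points will vanish, and
  the rest is grouped by simplex.\<close>

lemma sum_glue:
  fixes g :: "nat \<Rightarrow> 'b :: comm_monoid_add"
  shows "(\<Sum>i<length (glue F s m). g i) = g 0 +
    (\<Sum>h = 1..m. (\<Sum>k<length (s h). g (length (glue F s (h - 1)) + k)) + g (length (glue F s h) - 1))"
proof (induction m)
  case (Suc m)
  have "(\<Sum>i<length (glue F s (Suc m)). g i) = (\<Sum>i<length (glue F s m). g i) +
      ((\<Sum>k<length (s (Suc m)). g (length (glue F s m) + k)) + g (length (glue F s (Suc m)) - 1))"
    by (simp add: sum_lessThan_add flip: add.assoc)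
  then show ?case
    unfolding Suc.IH by (simp add: add.assoc)
qed simp

lemma glue_index_cases:
  assumes "i < length (glue F s m)"
  obtains h where "h \<le> m" "i = length (glue F s h) - 1"
  | h k where "h \<in> {1..m}" "k < length (s h)" "i = length (glue F s (h - 1)) + k"
proof -
  have "(\<exists>h\<le>m. i = length (glue F s h) - 1) \<or>
      (\<exists>h\<in>{1..m}. \<exists>k<length (s h). i = length (glue F s (h - 1)) + k)"
    using assms
  proof (induction m)
    case (Suc m)
    consider "i < length (glue F s m)" | k where "k < length (s (Suc m))" "i = length (glue F s m) + k"
      | "i = length (glue F s (Suc m)) - 1"
      using Suc.prems
      by (cases "i < length (glue F s m)"; cases "i - length (glue F s m) < length (s (Suc m))")
         (auto simp: le_Suc_ex)
    then show ?case
    proof cases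
      case 1
      then show ?thesis
        using Suc.IH by (meson atLeastAtMost_iff le_SucI)
    next
      case 2
      then show ?thesis
        by (intro disjI2 bexI[of _ "Suc m"]) auto
    qed blast
  qed auto
  then show thesis
    using that by blast
qed

lemma length_glue_mono: "h \<le> h' \<Longrightarrow> length (glue F s h) \<le> length (glue F s h')"
  by (induction h' rule: dec_induct) simp_all

lemma length_glue_step: "1 \<le> h \<Longrightarrow> length (glue F s h) = length (glue F s (h - 1)) + length (s h) + 1"
  by (cases h) simp_all

lemma glue_segment:
  assumes "h \<in> {1..m}"
  obtains post where "glue F s m = butlast (glue F s (h - 1)) @ (F ! (h - 1) # s h @ [F ! h]) @ post"
proof -
  have "\<exists>post. glue F s m = butlast (glue F s (h - 1)) @ (F ! (h - 1) # s h @ [F ! h]) @ post"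
    using assms
  proof (induction m)
    case (Suc m)
    show ?case
    proof (cases "h = Suc m")
      case True
      then show ?thesis
        using glue_conv_butlast[of F s m] by (intro exI[of _ "[]"]) simp
    next
      case False
      with Suc obtain post
        where "glue F s m = butlast (glue F s (h - 1)) @ (F ! (h - 1) # s h @ [F ! h]) @ post"
        by auto
      then show ?thesis
        by (intro exI[of _ "post @ s (Suc m) @ [F ! Suc m]"]) simp
    qed
  qed simp
  then show thesis
    using that by blast
qed

text \<open>Positions are counted from \<open>F ! (h - 1)\<close>, the last point of its prefix;
  \<open>k\<close> runs through the whole segment, both ends included.\<close>

lemma nth_glue:
  assumes "h \<in> {1..m}" "k \<le> Suc (length (s h))"
  shows "glue F s m ! (length (glue F s (h - 1)) - 1 + k) = (F ! (h - 1) # s h @ [F ! h]) ! k"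
proof -
  obtain post where "glue F s m = butlast (glue F s (h - 1)) @ (F ! (h - 1) # s h @ [F ! h]) @ post"
    using glue_segment[OF assms(1)] .
  moreover have "(butlast (glue F s (h - 1)) @ (F ! (h - 1) # s h @ [F ! h]) @ post) !
      (length (butlast (glue F s (h - 1))) + k) = ((F ! (h - 1) # s h @ [F ! h]) @ post) ! k"
    by (rule nth_append_length_plus)
  moreover have "((F ! (h - 1) # s h @ [F ! h]) @ post) ! k = (F ! (h - 1) # s h @ [F ! h]) ! k"
    using assms(2) by (intro nth_append_left) simp
  ultimately show ?thesis
    by simp
qed

lemma set_glue: "set (glue F s m) = (!) F ` {..m} \<union> (\<Union>h\<in>{1..m}. set (s h))"
proof (induction m)
  case (Suc m)
  have "{..Suc m} = insert (Suc m) {..m}" "{1..Suc m} = insert (Suc m) {1..m}"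
    by auto
  then show ?case
    using Suc by auto
qed simp

lemma distinct_adj_glue:
  "distinct_adj (glue F s m) \<longleftrightarrow> (\<forall>h\<in>{1..m}. distinct_adj (F ! (h - 1) # s h @ [F ! h]))"
proof (induction m)
  case (Suc m)
  have "distinct_adj (butlast (glue F s m) @ F ! m # s (Suc m) @ [F ! Suc m]) \<longleftrightarrow>
      distinct_adj (butlast (glue F s m) @ [F ! m]) \<and> distinct_adj (F ! m # s (Suc m) @ [F ! Suc m])"
    by (auto simp: distinct_adj_append_iff)
  moreover have "{1..Suc m} = insert (Suc m) {1..m}"
    by auto
  ultimately show ?case
    unfolding glue_Suc glue_conv_butlast[symmetric] Suc by auto
qed simp

lemma chain_length_glue:
  "chain_length d (glue F s m) = (\<Sum>h = 1..m. chain_length d (F ! (h - 1) # s h @ [F ! h]))"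
proof (induction m)
  case 0
  then show ?case
    by (simp add: chain_length_def)
next
  case (Suc m)
  have "chain_length d (glue F s (Suc m)) =
      chain_length d (glue F s m) + chain_length d (F ! m # s (Suc m) @ [F ! Suc m])"
    unfolding glue_Suc chain_length_append[of d "butlast (glue F s m)" "F ! m"]
      glue_conv_butlast[symmetric] ..
  then show ?case
    using Suc by (simp del: glue.simps)
qed

section \<open>Omitting an inserted point\<close>

lemma omit_append:
  "omit i (x @ y) = (if i < length x then omit i x @ y else x @ omit (i - length x) y)"
  by (simp add: omit_def Suc_diff_le)

lemma length_omit: "i < length x \<Longrightarrow> length (omit i x) = length x - 1"
  by (simp add: omit_def)

lemma omit_glue:
  assumes "h \<in> {1..m}" "k < length (s h)"
  shows "omit (length (glue F s (h - 1)) + k) (glue F s m) = glue F (s(h := omit k (s h))) m"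
  using assms(1)
proof (induction m)
  case (Suc m)
  show ?case
  proof (cases "h = Suc m")
    case True
    have "glue F (s(h := omit k (s h))) m = glue F s m"
      using True by (intro glue_cong) auto
    then show ?thesis
      using True assms(2) by (simp add: omit_append fun_upd_same del: fun_upd_apply)
  next
    case False
    then have h: "h \<in> {1..m}"
      using Suc.prems by auto
    have "length (glue F s (h - 1)) + k < length (glue F s h)"
      using h assms(2) length_glue_step[of h F s] by simp
    also have "\<dots> \<le> length (glue F s m)"
      using h by (intro length_glue_mono) simp
    finally have "length (glue F s (h - 1)) + k < length (glue F s m)" .
    then show ?thesis
      using Suc.IH[OF h] False by (simp add: omit_append)
  qed
qed simp

section \<open>Recovering the simplices from the positions of the frame points\<close>

lemma nths_glue:
  assumes "\<And>h. h \<le> m \<Longrightarrow> length (glue F s h) - 1 \<in> A"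
    and "\<And>h k. h \<in> {1..m} \<Longrightarrow> k < length (s h) \<Longrightarrow> length (glue F s (h - 1)) + k \<notin> A"
  shows "nths (glue F s m) A = map ((!) F) [0..<Suc m]"
  using assms
proof (induction m)
  case 0
  then show ?case
    by simp
next
  case (Suc m)
  have "nths (glue F s m) A = map ((!) F) [0..<Suc m]"
    using Suc by simp
  moreover have "nths (s (Suc m)) {j. j + length (glue F s m) \<in> A} = []"
  proof -
    have "set (nths (s (Suc m)) {j. j + length (glue F s m) \<in> A}) = {}"
      unfolding set_nths using Suc.prems(2)[of "Suc m"] by (auto simp: add.commute)
    then show ?thesis
      by simp
  qed
  moreover have "length (s (Suc m)) + length (glue F s m) \<in> A"
    using Suc.prems(1)[of "Suc m"] by (simp add: add.commute)
  ultimately show ?case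
    by (simp add: nths_append nths_singleton)
qed

text \<open>Cuts the list at its last selected position, to match the recursion of
  \<open>glue\<close>, which also works from the right end.\<close>

lemma nths_eq_snoc:
  assumes "nths x A = G @ [b]"
  obtains y t where "x = y @ b # t" "nths y A = G" "length y \<in> A"
    "\<And>j. length y < j \<Longrightarrow> j < length x \<Longrightarrow> j \<notin> A"
proof -
  have "\<exists>y t. x = y @ b # t \<and> nths y A = G \<and> length y \<in> A \<and> (\<forall>j. length y < j \<and> j < length x \<longrightarrow> j \<notin> A)"
    using assms
  proof (induction x rule: rev_induct)
    case (snoc c x)
    show ?case
    proof (cases "length x \<in> A")
      case True
      then have "nths x A = G" "c = b"
        using snoc.prems by (simp_all add: nths_append nths_singleton)
      then have "x @ [c] = x @ b # [] \<and> nths x A = G \<and> length x \<in> A \<and>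
          (\<forall>j. length x < j \<and> j < length (x @ [c]) \<longrightarrow> j \<notin> A)"
        using True by auto
      then show ?thesis
        by blast
    next
      case False
      then have "nths x A = G @ [b]"
        using snoc.prems by (simp add: nths_append nths_singleton)
      then obtain y t where "x = y @ b # t" "nths y A = G" "length y \<in> A"
        "\<forall>j. length y < j \<and> j < length x \<longrightarrow> j \<notin> A"
        using snoc.IH by blast
      then have "x @ [c] = y @ b # (t @ [c]) \<and> nths y A = G \<and> length y \<in> A \<and>
          (\<forall>j. length y < j \<and> j < length (x @ [c]) \<longrightarrow> j \<notin> A)"
        using False by (auto simp: less_Suc_eq)
      then show ?thesis
        by blast
    qed
  qed simp
  then show thesis
    using that by blast
qed

text \<open>The last two frame points are located, and what lies between them is the last simplex.
  Since the two ends of \<open>x\<close> are selected, nothing precedes the first frame point or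
  follows the last one.\<close>

lemma glue_decomposition:
  assumes "nths x A = map ((!) F) [0..<Suc m]" "x \<noteq> []" "0 \<in> A" "length x - 1 \<in> A"
  shows "\<exists>s. x = glue F s m"
  using assms
proof (induction m arbitrary: x)
  case 0
  then have "nths x A = [] @ [F ! 0]"
    by simp
  then obtain y t where x: "x = y @ F ! 0 # t" "nths y A = []" "length y \<in> A"
    "\<And>j. length y < j \<Longrightarrow> j < length x \<Longrightarrow> j \<notin> A"
    using nths_eq_snoc by metis
  have "y = []"
    using x(2) 0 by (cases y) (simp_all add: nths_Cons)
  moreover have "t = []"
    using x(4)[of "length x - 1"] x(1) 0 by (cases t) auto
  ultimately show ?case
    using x(1) by simp
next
  case (Suc m)
  have "nths x A = map ((!) F) [0..<Suc m] @ [F ! Suc m]"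
    using Suc.prems by simp
  then obtain y t where x: "x = y @ F ! Suc m # t" "nths y A = map ((!) F) [0..<Suc m]" "length y \<in> A"
    "\<And>j. length y < j \<Longrightarrow> j < length x \<Longrightarrow> j \<notin> A"
    using nths_eq_snoc by metis
  have t: "t = []"
    using x(4)[of "length x - 1"] x(1) Suc.prems by (cases t) auto
  have "nths y A = map ((!) F) [0..<m] @ [F ! m]"
    using x(2) by simp
  then obtain y' u where y: "y = y' @ F ! m # u" "nths y' A = map ((!) F) [0..<m]" "length y' \<in> A"
    using nths_eq_snoc by metis
  have "nths (y' @ [F ! m]) A = map ((!) F) [0..<Suc m]"
    using y by (simp add: nths_append nths_singleton)
  from Suc.IH[OF this] obtain s where s: "y' @ [F ! m] = glue F s m"
    using Suc.prems y(3) by auto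
  \<comment> \<open>The new simplex is stored at an index which the shorter gluing does not
    read.\<close>
  have "glue F (s(Suc m := u)) m = glue F s m"
    by (intro glue_cong) auto
  then have "x = glue F (s(Suc m := u)) (Suc m)"
    using x(1) t y(1) s by simp
  then show ?case
    by blast
qed

text \<open>Without the set \<open>A\<close> of frame positions this fails: an inserted point may equal a point of \<open>F\<close>.\<close>

lemma glue_inject:
  assumes "glue F s m = glue F t m"
    and "\<And>h. h \<le> m \<Longrightarrow> length (glue F s h) - 1 \<in> A" "\<And>h. h \<le> m \<Longrightarrow> length (glue F t h) - 1 \<in> A"
    and "\<And>h k. h \<in> {1..m} \<Longrightarrow> k < length (s h) \<Longrightarrow> length (glue F s (h - 1)) + k \<notin> A"
    and "\<And>h k. h \<in> {1..m} \<Longrightarrow> k < length (t h) \<Longrightarrow> length (glue F t (h - 1)) + k \<notin> A"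
    and "h \<in> {1..m}"
  shows "s h = t h"
proof -
  have "\<forall>h\<in>{1..m}. s h = t h"
    using assms(1-5)
  proof (induction m)
    case (Suc m)
    \<comment> \<open>If the prefix for \<open>s\<close> were shorter, the last frame position of
      the prefix for \<open>t\<close> would fall among the points inserted by \<open>s\<close>. By
      symmetry the two prefixes have equal length.\<close>
    have aux: "\<not> length (glue F s m) < length (glue F t m)"
      if "glue F s (Suc m) = glue F t (Suc m)"
        and "\<And>h k. h \<in> {1..Suc m} \<Longrightarrow> k < length (s h) \<Longrightarrow> length (glue F s (h - 1)) + k \<notin> A"
        and "length (glue F t m) - 1 \<in> A" for s t
    proof
      assume less: "length (glue F s m) < length (glue F t m)"
      have "length (glue F s m) + length (s (Suc m)) = length (glue F t m) + length (t (Suc m))"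
        using arg_cong[OF that(1), of length] by simp
      then have "length (glue F t m) - 1 - length (glue F s m) < length (s (Suc m))"
        using less by simp
      from that(2)[OF _ this] that(3) less show False
        by simp
    qed
    have len: "length (glue F s m) = length (glue F t m)"
      using aux[of s t] aux[of t s] Suc.prems(1,4,5) Suc.prems(2,3)[of m] by fastforce
    then have "glue F s m = glue F t m" "s (Suc m) = t (Suc m)"
      using Suc.prems(1) by simp_all
    moreover have "\<forall>h\<in>{1..m}. s h = t h"
      using Suc.prems calculation(1) by (intro Suc.IH) auto
    ultimately show ?case
      by (metis atLeastAtMost_iff le_Suc_eq)
  qed simp
  then show ?thesis
    using assms(6) by blast
qed

section \<open>Transport of a complex along isomorphisms up to sign\<close>

text \<open>\<open>D\<close> inherits the complex axioms from \<open>C\<close>, as every element of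
  \<open>D\<close> is an image. The sign does no harm, since inversion is a homomorphism in a
  commutative group.\<close>

lemma iso_up_to_signI:
  assumes C: "is_chain_complex C" and D: "\<And>n. comm_group (grp D n)"
    and iso: "\<And>n. \<phi> n \<in> iso (grp C n) (grp D (n - k))"
    and boundary: "\<And>n x. x \<in> carrier (grp C n) \<Longrightarrow>
      bdry D (n - k) (\<phi> n x) = inv\<^bsub>grp D (n - k - 1)\<^esub> (\<phi> (n - 1) (bdry C n x))"
  shows "iso_up_to_sign C D k"
proof -
  have Cn: "bdry C n \<in> hom (grp C n) (grp C (n - 1))" "comm_group (grp C n)"
    and CC: "x \<in> carrier (grp C n) \<Longrightarrow> bdry C (n - 1) (bdry C n x) = \<one>\<^bsub>grp C (n - 2)\<^esub>" for n x
    using C by (simp_all add: is_chain_complex_def)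
  have grpC: "group (grp C n)" and grpD: "group (grp D n)" for n
    using Cn(2) D by (simp_all add: comm_group.axioms)
  have \<phi>: "\<phi> n \<in> hom (grp C n) (grp D (n - k))" for n
    using iso by (simp add: iso_def)
  have \<phi>': "\<phi> (n - 1) \<in> hom (grp C (n - 1)) (grp D (n - k - 1))" for n
    using \<phi>[of "n - 1"] by (simp add: algebra_simps)
  have surj: "\<exists>x\<in>carrier (grp C (n + k)). y = \<phi> (n + k) x" if "y \<in> carrier (grp D n)" for n y
    using iso[of "n + k"] that by (auto simp: iso_def bij_betw_def)
  have closed: "\<phi> (n - 1) (bdry C n x) \<in> carrier (grp D (n - k - 1))" if "x \<in> carrier (grp C n)" for n x
    using hom_in_carrier[OF \<phi>' hom_in_carrier[OF Cn(1) that]] .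
  have "is_chain_complex D"
    unfolding is_chain_complex_def
  proof (intro allI conjI ballI)
    fix n
    show "comm_group (grp D n)"
      by (rule D)
    have bd: "bdry D n (\<phi> (n + k) x) = inv\<^bsub>grp D (n - 1)\<^esub> (\<phi> (n + k - 1) (bdry C (n + k) x))"
      "\<phi> (n + k - 1) (bdry C (n + k) x) \<in> carrier (grp D (n - 1))"
      if "x \<in> carrier (grp C (n + k))" for x n
      using boundary[OF that] closed[OF that] by simp_all
    show "bdry D n \<in> hom (grp D n) (grp D (n - 1))"
    proof (rule homI)
      fix y
      assume "y \<in> carrier (grp D n)"
      then show "bdry D n y \<in> carrier (grp D (n - 1))"
        using surj bd group.inv_closed[OF grpD] by metis
    next
      fix y y'
      assume "y \<in> carrier (grp D n)" "y' \<in> carrier (grp D n)"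
      then obtain x x' where x: "x \<in> carrier (grp C (n + k))" "x' \<in> carrier (grp C (n + k))"
        and y: "y = \<phi> (n + k) x" "y' = \<phi> (n + k) x'"
        using surj by metis
      have xx: "x \<otimes>\<^bsub>grp C (n + k)\<^esub> x' \<in> carrier (grp C (n + k))"
        using x grpC by (simp add: group.is_monoid monoid.m_closed)
      have "y \<otimes>\<^bsub>grp D n\<^esub> y' = \<phi> (n + k) (x \<otimes>\<^bsub>grp C (n + k)\<^esub> x')"
        using hom_mult[OF \<phi> x] by (simp add: y)
      then have "bdry D n (y \<otimes>\<^bsub>grp D n\<^esub> y') =
          inv\<^bsub>grp D (n - 1)\<^esub> (\<phi> (n + k - 1) (bdry C (n + k) (x \<otimes>\<^bsub>grp C (n + k)\<^esub> x')))"
        using bd(1)[OF xx] by simp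
      also have "\<phi> (n + k - 1) (bdry C (n + k) (x \<otimes>\<^bsub>grp C (n + k)\<^esub> x')) =
          \<phi> (n + k - 1) (bdry C (n + k) x) \<otimes>\<^bsub>grp D (n - 1)\<^esub> \<phi> (n + k - 1) (bdry C (n + k) x')"
        using hom_mult[OF \<phi>'[of "n + k"]] hom_mult[OF Cn(1) x] hom_in_carrier[OF Cn(1)] x by simp
      also have "inv\<^bsub>grp D (n - 1)\<^esub> \<dots> = bdry D n y \<otimes>\<^bsub>grp D (n - 1)\<^esub> bdry D n y'"
        using comm_group.inv_mult[OF D] bd x by (simp add: y)
      finally show "bdry D n (y \<otimes>\<^bsub>grp D n\<^esub> y') = bdry D n y \<otimes>\<^bsub>grp D (n - 1)\<^esub> bdry D n y'" .
    qed
    fix y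
    assume "y \<in> carrier (grp D n)"
    then obtain x where x: "x \<in> carrier (grp C (n + k))" and y: "y = \<phi> (n + k) x"
      using surj by metis
    \<comment> \<open>Taking the inverse already in \<open>C\<close> absorbs the sign: the boundary
      of \<open>y\<close> is the image of \<open>z\<close>, and the compatibility assumption applies
      a second time.\<close>
    define z where "z = inv\<^bsub>grp C (n + k - 1)\<^esub> bdry C (n + k) x"
    have bx: "bdry C (n + k) x \<in> carrier (grp C (n + k - 1))"
      using hom_in_carrier[OF Cn(1) x] .
    then have z: "z \<in> carrier (grp C (n + k - 1))"
      by (simp add: z_def grpC)
    have hom1: "group_hom (grp C (n + k - 1)) (grp D (n - 1)) (\<phi> (n + k - 1))"
      using \<phi>'[of "n + k"] grpC grpD by (simp add: group_hom_def group_hom_axioms_def)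
    have hom2: "group_hom (grp C (n + k - 1)) (grp C (n + k - 2)) (bdry C (n + k - 1))"
      using Cn(1)[of "n + k - 1"] grpC by (simp add: group_hom_def group_hom_axioms_def)
    have hom3: "group_hom (grp C (n + k - 2)) (grp D (n - 2)) (\<phi> (n + k - 2))"
      using \<phi>[of "n + k - 2"] grpC grpD by (simp add: group_hom_def group_hom_axioms_def)
    have "bdry D n y = \<phi> (n + k - 1) z"
      unfolding y bd(1)[OF x] z_def using group_hom.hom_inv[OF hom1 bx] by simp
    moreover have "bdry C (n + k - 1) z = \<one>\<^bsub>grp C (n + k - 2)\<^esub>"
      unfolding z_def using group_hom.hom_inv[OF hom2 bx] CC[OF x] grpC by (simp add: group.is_monoid monoid.inv_one)
    ultimately have "bdry D (n - 1) (bdry D n y) = inv\<^bsub>grp D (n - 2)\<^esub> (\<phi> (n + k - 2) \<one>\<^bsub>grp C (n + k - 2)\<^esub>)"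
      using boundary[OF z] by (simp add: algebra_simps)
    then show "bdry D (n - 1) (bdry D n y) = \<one>\<^bsub>grp D (n - 2)\<^esub>"
      using group_hom.hom_one[OF hom3] grpD by (simp add: group.is_monoid monoid.inv_one)
  qed
  moreover have "\<phi> (n - 1) (bdry C n x) = inv\<^bsub>grp D (n - k - 1)\<^esub> (bdry D (n - k) (\<phi> n x))"
    if "x \<in> carrier (grp C n)" for n x
    using boundary[OF that] closed[OF that] group.inv_inv[OF grpD] by simp
  ultimately show ?thesis
    unfolding iso_up_to_sign_def using C iso by blast
qed

section \<open>Omitting two points\<close>

lemma nth_omit:
  "k < length x - 1 \<Longrightarrow> i < length x \<Longrightarrow> omit i x ! k = (if k < i then x ! k else x ! Suc k)"
  by (auto simp: omit_def nth_append min_def)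

text \<open>The simplicial identity for faces.\<close>

lemma omit_omit:
  assumes "j < i" "i < length x"
  shows "omit (i - 1) (omit j x) = omit j (omit i x)"
proof (rule nth_equalityI)
  show "length (omit (i - 1) (omit j x)) = length (omit j (omit i x))"
    using assms by (simp add: length_omit)
  fix k
  assume "k < length (omit (i - 1) (omit j x))"
  then have "k < length x - 1 - 1"
    using assms by (simp add: length_omit)
  then show "omit (i - 1) (omit j x) ! k = omit j (omit i x) ! k"
    using assms by (auto simp: nth_omit length_omit)
qed

lemma omit_order_simplices:
  assumes "u \<in> order_simplices P R n" "i < length u"
  shows "omit i u \<in> order_simplices P R (n - 1)"
proof -
  have "sorted_wrt (\<lambda>u v. R u v \<and> u \<noteq> v) (take i u @ u ! i # drop (Suc i) u)"
    using assms id_take_nth_drop[of i u] by (simp add: order_simplices_def)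
  then have "sorted_wrt (\<lambda>u v. R u v \<and> u \<noteq> v) (omit i u)"
    by (simp add: omit_def sorted_wrt_append)
  moreover have "set (omit i u) \<subseteq> set u"
    using set_take_subset[of i u] set_drop_subset[of "Suc i" u] by (simp add: omit_def)
  ultimately show ?thesis
    using assms by (auto simp: order_simplices_def length_omit)
qed

text \<open>The coface map: the position in a list of the point that has position \<open>j\<close>
  once point \<open>i\<close> is omitted.\<close>

definition skip :: "nat \<Rightarrow> nat \<Rightarrow> nat" where
  "skip i j = (if j < i then j else Suc j)"

text \<open>The terms \<open>(i, j)\<close> and \<open>(j, i - 1)\<close> for \<open>j < i\<close> cancel.\<close>

lemma sum_omit_omit_eq_0:
  "(\<Sum>i<length x. \<Sum>j<length x - 1. if P i \<and> P (skip i j)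
      then frag_cmul ((- 1) ^ (i + j)) (frag_of (omit j (omit i x))) else 0) = 0"
    (is "(\<Sum>i<_. \<Sum>j<_. ?f i j) = 0")
proof -
  define A where "A = {..<length x} \<times> {..<length x - 1}"
  define f where "f = (\<lambda>(i, j). ?f i j)"
  \<comment> \<open>The two orders of omitting the same pair of points of \<open>x\<close> are
    exchanged by this involution. \<open>P\<close> is tested at the original positions of both
    points, so the test is symmetric.\<close>
  define \<tau> :: "nat \<times> nat \<Rightarrow> nat \<times> nat" where "\<tau> = (\<lambda>(i, j). if j < i then (j, i - 1) else (Suc j, i))"
  have \<tau>: "\<tau> (\<tau> p) = p" "p \<in> A \<Longrightarrow> \<tau> p \<in> A" for p
    by (auto simp: \<tau>_def A_def split: prod.splits)
  have pair: "f (j, i - 1) = - f (i, j)" if "j < i" "i < length x" for i j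
  proof -
    have "skip j (i - 1) = i" "skip i j = j"
      using that by (auto simp: skip_def)
    then have "P (skip j (i - 1)) = P i" "P (skip i j) = P j"
      by simp_all
    moreover have "(- 1 :: int) ^ (i + j) = - ((- 1) ^ (j + (i - 1)))"
      using that by (cases i) (simp_all add: add.commute)
    ultimately show ?thesis
      using omit_omit[OF that] by (simp add: f_def)
  qed
  have "f (\<tau> p) = - f p" if "p \<in> A" for p
  proof -
    obtain i j where p: "p = (i, j)"
      by fastforce
    show ?thesis
    proof (cases "j < i")
      case True
      then show ?thesis
        using pair[of j i] that by (simp add: p \<tau>_def A_def)
    next
      case False
      then have "f (i, Suc j - 1) = - f (Suc j, i)"
        using that by (intro pair) (auto simp: p A_def)
      then show ?thesis
        using False by (simp add: p \<tau>_def)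
    qed
  qed
  then have "sum f A = (\<Sum>p\<in>A. - f p)"
    by (intro sum.reindex_bij_witness[of _ \<tau> \<tau>]) (use \<tau> in auto)
  \<comment> \<open>The whole sum equals its negative, and the group is torsion-free; the index set
    need not be split into halves.\<close>
  then have eq: "sum f A = - sum f A"
    by (simp add: sum_negf)
  have "sum f A = 0"
  proof (rule poly_mapping_eqI)
    fix y
    show "Poly_Mapping.lookup (sum f A) y = Poly_Mapping.lookup 0 y"
      using arg_cong[OF eq, of "\<lambda>c. Poly_Mapping.lookup c y"] by simp
  qed
  then show ?thesis
    by (simp add: A_def f_def sum.cartesian_product)
qed

section \<open>The frame complex\<close>

locale stable_framed_space = Metric_space M d for M :: "'a set" and d +
  fixes F :: "'a list" and m :: nat
  assumes frame_proper: "F \<in> proper_chains M (int m)"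
    and stable: "stable_frame M d F"
begin

definition simplices :: "nat \<Rightarrow> int \<Rightarrow> 'a list set" where
  "simplices h = order_simplices (interval M d (F ! (h - 1)) (F ! h)) (interval_le d (F ! (h - 1)))"

definition simplex_boundary :: "'a list \<Rightarrow> 'a list \<Rightarrow>\<^sub>0 int" where
  "simplex_boundary u = (\<Sum>i<length u. frag_cmul ((- 1) ^ i) (frag_of (omit i u)))"

sublocale based_complexes m simplices "\<lambda>u. int (length u) - 1" "\<lambda>h. simplex_boundary"
proof
  show "int (length u) - 1 = n" if "u \<in> simplices h n" for u h n
    using that by (simp add: simplices_def order_simplices_def)
  show "Poly_Mapping.keys (simplex_boundary u) \<subseteq> simplices h (n - 1)" if "u \<in> simplices h n" for u h n
    unfolding simplex_boundary_def
    using that omit_order_simplices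
    by (intro keys_sum_subset keys_frag_cmul_subset) (auto simp: simplices_def)
qed

abbreviation "glued s \<equiv> glue F s m"

definition frame_boundary :: "'a list \<Rightarrow> 'a list \<Rightarrow>\<^sub>0 int" where
  "frame_boundary x = (\<Sum>i<length x. if smooth d x i then frag_cmul ((- 1) ^ i) (frag_of (omit i x)) else 0)"

section \<open>Cells and chains with frame \<open>F\<close>\<close>

lemma
  shows length_frame: "length F = Suc m"
    and frame_mem: "h \<le> m \<Longrightarrow> F ! h \<in> M"
    and frame_neq: "h \<in> {1..m} \<Longrightarrow> F ! (h - 1) \<noteq> F ! h"
proof -
  show len: "length F = Suc m"
    using frame_proper by (auto simp: proper_chains_def)
  show "h \<le> m \<Longrightarrow> F ! h \<in> M"
    using frame_proper len by (auto simp: proper_chains_def)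
  show "h \<in> {1..m} \<Longrightarrow> F ! (h - 1) \<noteq> F ! h"
    using frame_proper len by (auto simp: proper_chains_def)
qed

text \<open>Cells with the total degree forgotten.\<close>

definition admissible :: "(nat \<Rightarrow> 'a list) \<Rightarrow> bool" where
  "admissible s \<longleftrightarrow> (\<forall>h\<in>{1..m}. s h \<in> simplices h (int (length (s h)) - 1))"

lemma mem_cells_iff:
  "s \<in> cells n \<longleftrightarrow> s \<in> extensional {1..m} \<and> admissible s \<and> (\<Sum>h = 1..m. int (length (s h)) - 1) = n"
  unfolding mem_cells admissible_def mdeg_def multidegrees_def by (auto simp: PiE_iff)

lemma mem_simplices_iff:
  assumes "h \<in> {1..m}"
  shows "u \<in> simplices h (int (length u) - 1) \<longleftrightarrow>
    distinct_adj (F ! (h - 1) # u @ [F ! h]) \<and> geodesic (F ! (h - 1) # u @ [F ! h])"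
  unfolding simplices_def
  using assms by (intro interval_simplex_iff_geodesic frame_mem frame_neq) auto

lemma admissible_segment:
  assumes "admissible s" "h \<in> {1..m}"
  shows "distinct_adj (F ! (h - 1) # s h @ [F ! h])" "geodesic (F ! (h - 1) # s h @ [F ! h])"
  using assms mem_simplices_iff by (auto simp: admissible_def)

lemma geodesic_segment_iff:
  "geodesic (a # u @ [b]) \<longleftrightarrow> set (a # u @ [b]) \<subseteq> M \<and> chain_length d (a # u @ [b]) = d a b"
  by (simp add: geodesic_def)

lemma chain_length_frame: "chain_length d F = (\<Sum>h = 1..m. d (F ! (h - 1)) (F ! h))"
  unfolding chain_length_def length_frame atLeastLessThanSuc_atLeastAtMost ..

lemma admissible_iff:
  "admissible s \<longleftrightarrow>
    set (glued s) \<subseteq> M \<and> distinct_adj (glued s) \<and> chain_length d (glued s) = chain_length d F"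
proof
  assume adm: "admissible s"
  have "set (s h) \<subseteq> M" if "h \<in> {1..m}" for h
    using admissible_segment(2)[OF adm that] by (auto simp: geodesic_segment_iff)
  then have "set (glued s) \<subseteq> M"
    unfolding set_glue using frame_mem by blast
  moreover have "chain_length d (glued s) = chain_length d F"
    unfolding chain_length_glue chain_length_frame
    using admissible_segment(2)[OF adm] by (intro sum.cong) (simp_all add: geodesic_segment_iff)
  ultimately show "set (glued s) \<subseteq> M \<and> distinct_adj (glued s) \<and> chain_length d (glued s) = chain_length d F"
    using admissible_segment(1)[OF adm] by (simp add: distinct_adj_glue)
next
  assume *: "set (glued s) \<subseteq> M \<and> distinct_adj (glued s) \<and> chain_length d (glued s) = chain_length d F"
  have sub: "set (F ! (h - 1) # s h @ [F ! h]) \<subseteq> M" if "h \<in> {1..m}" for h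
  proof -
    have "F ! (h - 1) \<in> M" "F ! h \<in> M"
      using that by (auto intro: frame_mem)
    moreover have "set (s h) \<subseteq> set (glued s)"
      using that unfolding set_glue by blast
    ultimately show ?thesis
      using * by auto
  qed
  have ge: "d (F ! (h - 1)) (F ! h) \<le> chain_length d (F ! (h - 1) # s h @ [F ! h])" if "h \<in> {1..m}" for h
    using dist_le_sum_steps[OF sub[OF that], of 0 "Suc (length (s h))"]
    by (simp add: chain_length_def One_nat_def nth_append)
  have "chain_length d (F ! (h - 1) # s h @ [F ! h]) = d (F ! (h - 1)) (F ! h)" if "h \<in> {1..m}" for h
  proof -
    have "(\<Sum>h = 1..m. d (F ! (h - 1)) (F ! h)) = (\<Sum>h = 1..m. chain_length d (F ! (h - 1) # s h @ [F ! h]))"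
      using * by (simp add: chain_length_glue chain_length_frame)
    \<comment> \<open>No segment is shorter than the distance of its ends, and the totals agree, so
      equality holds in every segment.\<close>
    from sum_mono_inv[OF this ge that] show ?thesis
      by simp
  qed
  then show "admissible s"
    unfolding admissible_def using * sub
    by (auto simp: mem_simplices_iff geodesic_segment_iff distinct_adj_glue)
qed

text \<open>An inserted point and both of its neighbours lie on the same geodesic segment.\<close>

lemma smooth_glued:
  assumes "admissible s" and h: "h \<in> {1..m}" and k: "k < length (s h)"
  shows "smooth d (glued s) (length (glue F s (h - 1)) + k)"
proof -
  let ?l = "length (glue F s (h - 1))" and ?x = "F ! (h - 1) # s h @ [F ! h]"
  note x = admissible_segment[OF assms(1) h]
  have l: "1 \<le> ?l" "?l + k + 1 < length (glued s)"
  proof -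
    show "1 \<le> ?l"
      using length_glue_pos[of F s "h - 1"] by linarith
    show "?l + k + 1 < length (glued s)"
      using length_glue_mono[of h m F s] length_glue_step[of h F s] h k by simp
  qed
  have "between d (?x ! k) (?x ! Suc k) (?x ! Suc (Suc k))"
    using k by (intro geodesic_between[OF x(2)]) simp_all
  moreover have "?x ! k \<noteq> ?x ! Suc k" "?x ! Suc k \<noteq> ?x ! Suc (Suc k)"
    using k by (intro geodesic_neq[OF x(2,1)]; simp)+
  moreover have "glued s ! (?l - 1 + k) = ?x ! k" "glued s ! (?l - 1 + Suc k) = ?x ! Suc k"
    "glued s ! (?l - 1 + Suc (Suc k)) = ?x ! Suc (Suc k)"
    using k by (intro nth_glue[OF h]; simp)+
  ultimately have "strictly_between d (glued s ! (?l - 1 + k)) (glued s ! (?l - 1 + Suc k))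
      (glued s ! (?l - 1 + Suc (Suc k)))"
    by (simp only: strictly_between_def simp_thms)
  \<comment> \<open>Writing \<open>?l\<close> as a successor reconciles the truncated differences
    \<open>?l - 1 + k\<close> and \<open>?l + k - 1\<close>.\<close>
  moreover obtain l' where "?l = Suc l'"
    using l(1) by (cases ?l) simp_all
  ultimately show ?thesis
    using l(2) by (simp add: smooth_def One_nat_def)
qed

text \<open>This is where stability enters. The neighbours of an inner frame point lie on geodesics
  to the adjacent frame points, and stability forbids the frame point to be strictly between them.
  The two ends are singular by definition.\<close>

lemma not_smooth_glued:
  assumes adm: "admissible s" and "h \<le> m"
  shows "\<not> smooth d (glued s) (length (glue F s h) - 1)"
proof
  let ?l = "length (glue F s h)"
  assume smooth: "smooth d (glued s) (?l - 1)"
  have "h \<noteq> 0"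
  proof
    assume "h = 0"
    with smooth show False
      by (simp add: smooth_def)
  qed
  moreover have "h \<noteq> m"
  proof
    assume "h = m"
    moreover have "?l - 1 + 1 < length (glued s)"
      using smooth by (simp only: smooth_def)
    ultimately show False
      by (simp add: One_nat_def)
  qed
  ultimately have h: "h \<in> {1..m}" "Suc h \<in> {1..m}"
    using assms(2) by auto
  let ?x = "F ! (h - 1) # s h @ [F ! h]" and ?y = "F ! h # s (Suc h) @ [F ! Suc h]"
  \<comment> \<open>The neighbours of \<open>F ! h\<close> in the glued chain. If a simplex is
    empty, its neighbour is the adjacent frame point; indexing the whole segment covers both
    cases.\<close>
  define p q where "p = ?x ! length (s h)" and "q = ?y ! 1"
  have x: "geodesic ?x" and y: "geodesic ?y"
    using admissible_segment(2)[OF adm h(1)] admissible_segment(2)[OF adm h(2)] by simp_all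
  have "glued s ! (?l - 1 + 0) = F ! h" "glued s ! (?l - 1 + 1) = q"
    using nth_glue[OF h(2), of 0 s F] nth_glue[OF h(2), of 1 s F] by (simp_all add: q_def)
  moreover have "glued s ! (length (glue F s (h - 1)) - 1 + length (s h)) = p"
    using nth_glue[OF h(1), of "length (s h)" s F] by (simp add: p_def)
  moreover have "?l - 1 - 1 = length (glue F s (h - 1)) - 1 + length (s h)"
  proof -
    have "?l = length (glue F s (h - 1)) + length (s h) + 1"
      using h by (intro length_glue_step) simp
    then show ?thesis
      using length_glue_pos[of F s "h - 1"] by arith
  qed
  ultimately have "strictly_between d p (F ! h) q"
    using smooth by (simp add: smooth_def)
  moreover have "between d (F ! (h - 1)) p (F ! h)"
    using geodesic_between[OF x, of 0 "length (s h)" "Suc (length (s h))"] by (simp add: p_def)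
  moreover have "between d (F ! h) q (F ! (h + 1))"
    using geodesic_between[OF y, of 0 1 "Suc (length (s (Suc h)))"]
    by (simp add: q_def One_nat_def)
  moreover have "p \<in> set ?x" "q \<in> set ?y"
    unfolding p_def q_def by (intro nth_mem; simp)+
  then have "p \<in> M" "q \<in> M"
    using x y unfolding geodesic_def by blast+
  moreover have "1 \<le> h" "h + 1 < length F"
    using h by (simp_all add: length_frame)
  ultimately show False
    using stable unfolding stable_frame_def by blast
qed

text \<open>For glued chains, smoothness becomes a question of positions, without reference to
  distances.\<close>

lemma smooth_glued_iff:
  assumes "admissible s" "i < length (glued s)"
  shows "smooth d (glued s) i \<longleftrightarrow> (\<forall>h\<le>m. i \<noteq> length (glue F s h) - 1)"
  using glue_index_cases[OF assms(2)] smooth_glued[OF assms(1)] not_smooth_glued[OF assms(1)] by metis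

lemma frame_glued:
  assumes "admissible s"
  shows "frame d (glued s) = F"
proof -
  have "frame d (glued s) = map ((!) F) [0..<Suc m]"
    unfolding frame_def
    using smooth_glued[OF assms] not_smooth_glued[OF assms] by (intro nths_glue) auto
  then show ?thesis
    using map_nth[of F] by (simp only: length_frame)
qed

lemma glued_mem_frame_chains:
  assumes "s \<in> cells (n - 2 * int m)"
  shows "glued s \<in> frame_chains M d F n"
proof -
  have s: "admissible s" "(\<Sum>h = 1..m. int (length (s h)) - 1) = n - 2 * int m"
    using assms by (simp_all add: mem_cells_iff)
  have "int (length (glued s)) = n + 1"
    using s(2) by (simp add: length_glue sum_subtractf)
  then show ?thesis
    using s(1) frame_glued admissible_iff by (simp add: frame_chains_def proper_chains_iff)
qed

lemma frame_chain_eq_glued: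
  assumes "x \<in> frame_chains M d F n"
  shows "\<exists>s\<in>cells (n - 2 * int m). x = glued s"
proof -
  have x: "x \<noteq> []" "int (length x) = n + 1" "set x \<subseteq> M" "distinct_adj x"
    "chain_length d x = chain_length d F" "frame d x = F"
    using assms by (simp_all add: frame_chains_def proper_chains_iff)
  have "nths x {i. \<not> smooth d x i} = map ((!) F) [0..<Suc m]"
    using x(6) map_nth[of F] by (simp only: frame_def length_frame)
  from glue_decomposition[OF this x(1)] obtain s where s: "x = glued s"
    by (auto simp: smooth_def)
  \<comment> \<open>Cells are extensional functions; the decomposition leaves the values outside the
    index range open.\<close>
  define t where "t = restrict s {1..m}"
  have t: "x = glued t"
    unfolding s t_def by (intro glue_cong) simp
  then have "admissible t"
    using x by (simp add: admissible_iff)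
  moreover have "(\<Sum>h = 1..m. int (length (t h)) - 1) = n - 2 * int m"
    using x(2) by (simp add: t length_glue sum_subtractf)
  ultimately show ?thesis
    using t by (intro bexI[of _ t]) (simp_all add: mem_cells_iff t_def)
qed

lemma glued_inject:
  assumes "s \<in> cells n" "t \<in> cells n'" "glued s = glued t"
  shows "s = t"
proof (rule extensionalityI[of _ "{1..m}"])
  have adm: "admissible s" "admissible t"
    using assms by (simp_all add: mem_cells_iff)
  fix h
  assume h: "h \<in> {1..m}"
  show "s h = t h"
    using h smooth_glued[OF adm(1)] smooth_glued[OF adm(2)]
      not_smooth_glued[OF adm(1)] not_smooth_glued[OF adm(2)]
    \<comment> \<open>Both gluings have as frame positions exactly the singular positions of the
      common chain.\<close>
    by (intro glue_inject[OF assms(3), where A = "{i. \<not> smooth d (glued s) i}"]) (auto simp: assms(3))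
qed (use assms in \<open>simp_all add: mem_cells_iff\<close>)

text \<open>One inverse serves all degrees, because \<open>glued_inject\<close> also compares cells
  of different degrees.\<close>

definition unglue :: "'a list \<Rightarrow> nat \<Rightarrow> 'a list" where
  "unglue x = (THE s. x = glued s \<and> (\<exists>n. s \<in> cells n))"

lemma unglue_glued: "s \<in> cells n \<Longrightarrow> unglue (glued s) = s"
  unfolding unglue_def using glued_inject by blast

lemma unglue_closed:
  assumes "x \<in> frame_chains M d F n"
  shows "unglue x \<in> cells (n - 2 * int m)" and "glued (unglue x) = x"
proof -
  obtain s where "s \<in> cells (n - 2 * int m)" "x = glued s"
    using frame_chain_eq_glued[OF assms] by blast
  then show "unglue x \<in> cells (n - 2 * int m)" "glued (unglue x) = x"
    by (simp_all add: unglue_glued)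
qed

section \<open>The boundary of a glued chain\<close>

lemma omit_cells:
  assumes "s \<in> cells n" "h \<in> {1..m}" "k < length (s h)"
  shows "s(h := omit k (s h)) \<in> cells (n - 1)"
proof -
  have "admissible (s(h := omit k (s h)))"
    using assms omit_order_simplices
    by (fastforce simp: mem_cells_iff admissible_def simplices_def length_omit)
  moreover have "(\<Sum>g = 1..m. int (length ((s(h := omit k (s h))) g)) - 1) = n - 1"
    using assms by (simp add: mem_cells_iff sum.remove[of _ h] length_omit)
  ultimately show ?thesis
    using assms by (auto simp: mem_cells_iff extensional_def)
qed

lemma frame_boundary_glued:
  assumes "admissible s"
  shows "frame_boundary (glued s) = (\<Sum>h = 1..m. \<Sum>k<length (s h).
    frag_cmul ((- 1) ^ (length (glue F s (h - 1)) + k)) (frag_of (glued (s(h := omit k (s h))))))"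
proof -
  have "\<not> smooth d (glued s) 0"
    by (simp add: smooth_def)
  then show ?thesis
    unfolding frame_boundary_def sum_glue
    using not_smooth_glued[OF assms] smooth_glued[OF assms]
    by (simp add: omit_glue)
qed

lemma frame_boundary_closed:
  assumes "x \<in> frame_chains M d F n"
  shows "Poly_Mapping.keys (frame_boundary x) \<subseteq> frame_chains M d F (n - 1)"
proof -
  obtain s where s: "s \<in> cells (n - 2 * int m)" "x = glued s"
    using frame_chain_eq_glued[OF assms] by blast
  then have "admissible s"
    by (simp add: mem_cells_iff)
  have "glued (s(h := omit k (s h))) \<in> frame_chains M d F (n - 1)" if "h \<in> {1..m}" "k < length (s h)" for h k
  proof (rule glued_mem_frame_chains)
    show "s(h := omit k (s h)) \<in> cells (n - 1 - 2 * int m)"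
      using omit_cells[OF s(1) that] by (simp add: algebra_simps)
  qed
  then show ?thesis
    unfolding s(2) frame_boundary_glued[OF \<open>admissible s\<close>]
    by (intro keys_sum_subset keys_frag_cmul_subset) simp
qed

text \<open>Both chains are glued, so it is enough that \<open>skip i\<close> takes the frame
  positions of the shorter one to those of the longer one. Prefixes that end before the omitted
  point keep their length, and the later ones lose one point.\<close>

lemma smooth_omit_iff:
  assumes "x \<in> frame_chains M d F n" "i < length x" "smooth d x i" "j < length x - 1"
  shows "smooth d (omit i x) j \<longleftrightarrow> smooth d x (skip i j)"
proof -
  obtain s where s: "s \<in> cells (n - 2 * int m)" "x = glued s"
    using frame_chain_eq_glued[OF assms(1)] by blast
  then have adm: "admissible s"
    by (simp add: mem_cells_iff)
  obtain h k where h: "h \<in> {1..m}" and k: "k < length (s h)" and i: "i = length (glue F s (h - 1)) + k"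
    using glue_index_cases[of i F s m] assms(2,3) not_smooth_glued[OF adm] s(2) by metis
  define t where "t = s(h := omit k (s h))"
  have adm': "admissible t"
    using omit_cells[OF s(1) h k] by (simp add: mem_cells_iff t_def)
  have omit: "omit i x = glued t"
    unfolding s(2) i t_def using h k by (intro omit_glue) simp_all
  have pos: "skip i (length (glue F t g) - 1) = length (glue F s g) - 1" if "g \<le> m" for g
  proof (cases "g < h")
    case True
    then have "glue F t g = glue F s g"
      unfolding t_def by (intro glue_cong) auto
    moreover have "length (glue F s g) \<le> length (glue F s (h - 1))"
      using True by (intro length_glue_mono) simp
    then have "length (glue F s g) - 1 < i"
      using length_glue_pos[of F s g] i by linarith
    ultimately show ?thesis
      by (simp add: skip_def)
  next
    case False
    then have hg: "h \<in> {1..g}" "h \<le> g"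
      using h by auto
    have le: "length (glue F s (h - 1)) + length (s h) + 1 \<le> length (glue F s g)"
      using length_glue_mono[OF hg(2), of F s] length_glue_step[of h F s] h by simp
    have "glue F t g = omit i (glue F s g)"
      unfolding i t_def using hg(1) k by (intro omit_glue[symmetric]) simp_all
    then have "length (glue F t g) = length (glue F s g) - 1"
      using le k by (simp add: length_omit i)
    moreover have "\<not> length (glue F s g) - 1 - 1 < i" "Suc (length (glue F s g) - 1 - 1) = length (glue F s g) - 1"
      using le k i by linarith+
    ultimately show ?thesis
      by (simp only: skip_def if_False)
  qed
  have inj: "skip i a = skip i b \<longleftrightarrow> a = b" for a b
    by (auto simp: skip_def)
  have "length (glued t) = length x - 1"
    using assms(2) by (simp flip: omit add: length_omit)
  then have "smooth d (omit i x) j \<longleftrightarrow> (\<forall>g\<le>m. skip i j \<noteq> skip i (length (glue F t g) - 1))"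
    using smooth_glued_iff[OF adm', of j] assms(4) by (simp add: omit inj)
  also have "\<dots> \<longleftrightarrow> (\<forall>g\<le>m. skip i j \<noteq> length (glue F s g) - 1)"
    using pos by simp
  also have "\<dots> \<longleftrightarrow> smooth d x (skip i j)"
  proof -
    have "skip i j < length (glued s)"
      using assms(4) unfolding s(2) skip_def by (cases "j < i") simp_all
    from smooth_glued_iff[OF adm this] show ?thesis
      by (simp only: s(2))
  qed
  finally show ?thesis .
qed

text \<open>\<open>smooth_omit_iff\<close> expresses the second smoothness test in terms of
  \<open>x\<close> itself, which is the form needed for the pairwise cancellation.\<close>

lemma frame_boundary_boundary:
  assumes x: "x \<in> frame_chains M d F n"
  shows "frag_extend frame_boundary (frame_boundary x) = 0"
proof -
  let ?t = "\<lambda>i j. frag_cmul ((- 1) ^ (i + j)) (frag_of (omit j (omit i x)))"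
  have "frag_extend frame_boundary (frame_boundary x) = (\<Sum>i<length x. frag_extend frame_boundary
      (if smooth d x i then frag_cmul ((- 1) ^ i) (frag_of (omit i x)) else 0))"
    unfolding frame_boundary_def[of x] by (simp only: frag_extend_sum finite_lessThan o_def)
  also have "\<dots> = (\<Sum>i<length x. \<Sum>j<length x - 1. if smooth d x i \<and> smooth d x (skip i j) then ?t i j else 0)"
  proof (rule sum.cong)
    fix i
    assume i: "i \<in> {..<length x}"
    show "frag_extend frame_boundary (if smooth d x i then frag_cmul ((- 1) ^ i) (frag_of (omit i x)) else 0) =
        (\<Sum>j<length x - 1. if smooth d x i \<and> smooth d x (skip i j) then ?t i j else 0)"
    proof (cases "smooth d x i")
      case True
      have "frame_boundary (omit i x) = (\<Sum>j<length x - 1. if smooth d x (skip i j)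
          then frag_cmul ((- 1) ^ j) (frag_of (omit j (omit i x))) else 0)"
        unfolding frame_boundary_def using i smooth_omit_iff[OF x _ True]
        by (intro sum.cong) (simp_all add: length_omit)
      then show ?thesis
        using True
        by (auto simp: frag_extend_cmul frag_cmul_sum power_add intro!: sum.cong)
    qed simp
  qed simp
  also have "\<dots> = 0"
    by (rule sum_omit_omit_eq_0)
  finally show ?thesis .
qed

lemma frame_complex_eq: "frame_complex M d F =
    \<lparr>grp = (\<lambda>n. free_Abelian_group (frame_chains M d F n)), bdry = (\<lambda>n. frag_extend frame_boundary)\<rparr>"
  unfolding frame_complex_def frame_boundary_def ..

lemma is_chain_complex_frame_complex: "is_chain_complex (frame_complex M d F)"
  unfolding is_chain_complex_def frame_complex_eq graded_complex.simps
proof (intro allI conjI ballI)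
  fix n
  show "comm_group (free_Abelian_group (frame_chains M d F n))"
    by (rule abelian_free_Abelian_group)
  show "frag_extend frame_boundary
      \<in> hom (free_Abelian_group (frame_chains M d F n)) (free_Abelian_group (frame_chains M d F (n - 1)))"
    by (rule frag_extend_hom) (rule frame_boundary_closed)
  fix c
  assume "c \<in> carrier (free_Abelian_group (frame_chains M d F n))"
  then have "frag_extend frame_boundary (frame_boundary x) = 0" if "x \<in> Poly_Mapping.keys c" for x
    using that by (intro frame_boundary_boundary) auto
  from frag_extend_eq_0[OF this]
  show "frag_extend frame_boundary (frag_extend frame_boundary c) =
      \<one>\<^bsub>free_Abelian_group (frame_chains M d F (n - 2))\<^esub>"
    unfolding frag_extend_frag_extend one_free_Abelian_group .
qed

text \<open>Each segment adds \<open>length (s g) + 1\<close> points, which is its degree plus 2, so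
  parities of lengths follow sums of degrees. The count starts with the one point
  \<open>F ! 0\<close>, hence the minus sign.\<close>

lemma length_glue_sign:
  assumes "h \<in> {1..m}"
  shows "(- 1) ^ length (glue F s (h - 1)) = - koszul_sign (mdeg s) h"
proof -
  have "even (length (glue F s j)) \<longleftrightarrow> odd (\<Sum>g = 1..<Suc j. mdeg s g)" if "j \<le> m" for j
    using that
  proof (induction j)
    case (Suc j)
    then have "mdeg s (Suc j) = int (length (s (Suc j))) - 1"
      by (simp add: mdeg_def)
    then have "(\<Sum>g = 1..<Suc (Suc j). mdeg s g) = (\<Sum>g = 1..<Suc j. mdeg s g) + (int (length (s (Suc j))) - 1)"
      by simp
    then show ?case
      using Suc by auto
  qed simp
  moreover have "h - 1 \<le> m" "Suc (h - 1) = h"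
    using assms by (auto simp: One_nat_def)
  ultimately have "even (length (glue F s (h - 1))) \<longleftrightarrow> odd (\<Sum>g = 1..<h. mdeg s g)"
    by metis
  then show ?thesis
    by (simp add: koszul_sign_def minus_one_power_iff)
qed

lemma frame_boundary_glued_eq:
  assumes "s \<in> cells n"
  shows "frame_boundary (glued s) = - frag_extend (\<lambda>t. frag_of (glued t)) (cell_boundary s)"
proof -
  have "admissible s"
    using assms by (simp add: mem_cells_iff)
  have "frag_extend (\<lambda>t. frag_of (glued t)) (cell_boundary s) =
    (\<Sum>h = 1..m. \<Sum>k<length (s h).
      frag_cmul (koszul_sign (mdeg s) h * (- 1) ^ k) (frag_of (glued (s(h := omit k (s h))))))"
    unfolding cell_boundary_def simplex_boundary_def
    by (simp only: frag_extend_sum finite_atLeastAtMost finite_lessThan o_def frag_extend_cmul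
        frag_extend_of frag_cmul_sum frag_cmul_cmul)
  moreover have "frame_boundary (glued s) = (\<Sum>h = 1..m. \<Sum>k<length (s h).
      - frag_cmul (koszul_sign (mdeg s) h * (- 1) ^ k) (frag_of (glued (s(h := omit k (s h))))))"
    unfolding frame_boundary_glued[OF \<open>admissible s\<close>]
    by (intro sum.cong refl) (simp add: power_add length_glue_sign del: fun_upd_apply)
  ultimately show ?thesis
    by (simp only: sum_negf)
qed

section \<open>The isomorphism of complexes\<close>

abbreviation "to_cells \<equiv> frag_extend (\<lambda>x. frag_of (unglue x))"

lemma to_cells_iso:
  "to_cells \<in> iso (free_Abelian_group (frame_chains M d F n)) (free_Abelian_group (cells (n - 2 * int m)))"
proof -
  let ?g = "frag_extend (\<lambda>t. frag_of (glued t))"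
  let ?A = "carrier (free_Abelian_group (frame_chains M d F n))"
  let ?B = "carrier (free_Abelian_group (cells (n - 2 * int m)))"
  have hom: "to_cells \<in> hom (free_Abelian_group (frame_chains M d F n)) (free_Abelian_group (cells (n - 2 * int m)))"
    using unglue_closed(1) by (intro frag_extend_hom) simp
  have hom': "?g \<in> hom (free_Abelian_group (cells (n - 2 * int m))) (free_Abelian_group (frame_chains M d F n))"
    using glued_mem_frame_chains by (intro frag_extend_hom) simp
  have "bij_betw to_cells ?A ?B"
  proof (rule bij_betwI[where g = ?g])
    show "to_cells \<in> ?A \<rightarrow> ?B" "?g \<in> ?B \<rightarrow> ?A"
      using hom hom' by (simp_all only: hom_def mem_Collect_eq)
    show "?g (to_cells c) = c" if "c \<in> ?A" for c
    proof -
      have "?g (to_cells c) = frag_extend frag_of c"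
        unfolding frag_extend_frag_extend frag_extend_of
        by (rule frag_extend_eq) (use that unglue_closed(2) in auto)
      then show ?thesis
        by (simp only: frag_expansion[symmetric])
    qed
    show "to_cells (?g c) = c" if "c \<in> ?B" for c
    proof -
      have "to_cells (?g c) = frag_extend frag_of c"
        unfolding frag_extend_frag_extend frag_extend_of
        by (rule frag_extend_eq) (use that unglue_glued in auto)
      then show ?thesis
        by (simp only: frag_expansion[symmetric])
    qed
  qed
  with hom show ?thesis
    by (simp add: iso_def)
qed

lemma to_cells_closed:
  "Poly_Mapping.keys c \<subseteq> frame_chains M d F n \<Longrightarrow>
    Poly_Mapping.keys (to_cells c) \<subseteq> cells (n - 2 * int m)"
  by (rule keys_frag_extend_subset) (auto dest: unglue_closed(1))

text \<open>\<open>frame_boundary_glued_eq\<close> read through the inverse bijection and extended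
  linearly.\<close>

lemma cell_boundary_to_cells:
  assumes "Poly_Mapping.keys c \<subseteq> frame_chains M d F n"
  shows "frag_extend cell_boundary (to_cells c) = - to_cells (frag_extend frame_boundary c)"
proof -
  have "cell_boundary (unglue x) = - to_cells (frame_boundary x)" if x: "x \<in> frame_chains M d F n" for x
  proof -
    let ?s = "unglue x"
    note s = unglue_closed[OF x]
    have "to_cells (frag_extend (\<lambda>t. frag_of (glued t)) (cell_boundary ?s)) = frag_extend frag_of (cell_boundary ?s)"
      unfolding frag_extend_frag_extend frag_extend_of
      using cell_boundary_closed[OF s(1)] unglue_glued by (intro frag_extend_eq) auto
    then have "to_cells (frag_extend (\<lambda>t. frag_of (glued t)) (cell_boundary ?s)) = cell_boundary ?s"
      by (simp only: frag_expansion[symmetric])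
    then show ?thesis
      using frame_boundary_glued_eq[OF s(1)] s(2) by (simp add: frag_extend_minus)
  qed
  then have "frag_extend cell_boundary (to_cells c) = frag_extend (\<lambda>x. - to_cells (frame_boundary x)) c"
    unfolding frag_extend_frag_extend frag_extend_of
    using assms by (intro frag_extend_eq) auto
  also have "\<dots> = - to_cells (frag_extend frame_boundary c)"
    unfolding frag_extend_frag_extend
    by (rule frag_extend_uminus)
  finally show ?thesis .
qed

text \<open>Of the two isomorphisms composed here, \<open>to_cells\<close> anticommutes with the
  boundaries and \<open>cells_to_total\<close> commutes with them, so one and the same sign occurs
  in all degrees.\<close>

lemma frame_complex_iso: "iso_up_to_sign (frame_complex M d F) Tot (2 * int m)"
proof (rule iso_up_to_signI)
  let ?\<phi> = "\<lambda>n c. cells_to_total (n - 2 * int m) (to_cells c)"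
  show "is_chain_complex (frame_complex M d F)"
    by (rule is_chain_complex_frame_complex)
  show "comm_group (grp Tot n)" for n
    by (rule comm_group_Tot)
  show "?\<phi> n \<in> iso (grp (frame_complex M d F) n) (grp Tot (n - 2 * int m))" for n
    using iso_set_trans[OF to_cells_iso cells_to_total_iso] by (simp add: frame_complex_eq o_def)
  fix n c
  assume "c \<in> carrier (grp (frame_complex M d F) n)"
  then have c: "Poly_Mapping.keys c \<subseteq> frame_chains M d F n"
    by (simp add: frame_complex_eq)
  from cells_to_total_boundary[OF to_cells_closed[OF c]]
  have "bdry Tot (n - 2 * int m) (?\<phi> n c) =
      cells_to_total (n - 2 * int m - 1) (- to_cells (frag_extend frame_boundary c))"
    by (simp only: cell_boundary_to_cells[OF c])
  moreover have "cells_to_total (n - 2 * int m - 1) (- b) =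
      inv\<^bsub>grp Tot (n - 2 * int m - 1)\<^esub> (cells_to_total (n - 2 * int m - 1) b)"
    if b: "Poly_Mapping.keys b \<subseteq> cells (n - 2 * int m - 1)" for b
    using group_hom.hom_inv[of "free_Abelian_group (cells (n - 2 * int m - 1))"
        "grp Tot (n - 2 * int m - 1)" "cells_to_total (n - 2 * int m - 1)" b] b
      cells_to_total_hom comm_group.axioms(2)[OF comm_group_Tot]
    by (simp add: group_hom_def group_hom_axioms_def)
  moreover have "Poly_Mapping.keys (to_cells (frag_extend frame_boundary c)) \<subseteq> cells (n - 1 - 2 * int m)"
    by (rule to_cells_closed[OF keys_frag_extend_subset[OF c frame_boundary_closed]])
  ultimately show "bdry Tot (n - 2 * int m) (?\<phi> n c) = inv\<^bsub>grp Tot (n - 2 * int m - 1)\<^esub>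
      (?\<phi> (n - 1) (bdry (frame_complex M d F) n c))"
    by (simp only: frame_complex_eq graded_complex.simps diff_right_commute[of n 1])
qed

end

theorem theorem4p4:
  fixes X :: "'a set" and d :: "'a \<Rightarrow> 'a \<Rightarrow> real" and F :: "'a list" and m :: nat
  assumes "Metric_space X d"
    and "F \<in> proper_chains X (int m)"
    and "stable_frame X d F"
  shows "iso_up_to_sign
    (frame_complex X d F)
    (total_complex m (\<lambda>h. order_complex (interval X d (F ! (h - 1)) (F ! h))
                                         (interval_le d (F ! (h - 1)))))
    (2 * int m)"
proof -
  interpret stable_framed_space X d F m
    using assms by (simp add: stable_framed_space_def stable_framed_space_axioms_def)
  have "based_complex = (\<lambda>h. order_complex (interval X d (F ! (h - 1)) (F ! h)) (interval_le d (F ! (h - 1))))"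
    unfolding order_complex_def
    by (rule ext) (simp only: based_complex_def, simp only: simplices_def simplex_boundary_def[abs_def])
  then show ?thesis
    using frame_complex_iso by simp
qed

end
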